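(* Let $F$ be a tract with a fixed involution, let $(M_1,\dots,M_s)$ be a flag $F$-matroid on a finite totally ordered set $E$, and let $I,J$ be disjoint subsets of $E$. Then $(M_1\backslash I/J,\dots,M_s\backslash I/J)$ is a flag $F$-matroid on $E\setminus(I\cup J)$, where $M\backslash I/J$ denotes $(M\backslash I)/J$.
   Context: A tract is a commutative multiplicative monoid $F$ with identity $1$ and absorbing element $0$ such that $F^\times=F\setminus\{0\}$ is a group, together with a subset $N_F\subseteq\mathbb{N}[F^\times]$ (the nullset) such that $0\in N_F$, $1\notin N_F$, there is a unique $\epsilon\in F^\times$ with $1+\epsilon\in N_F$, and $N_F$ is stable under multiplication by $F^\times$. An involution is a tract morphism $\tau:F\to F$ with $\tau^2=\mathrm{id}$. A Grassmann–Plücker function of rank $r$ on $E$ is a map $\varphi:E^r\to F$, not identically zero, alternating (swapping two arguments multiplies the value by $\epsilon$; value $0$ if two arguments coincide), with $\sum_{k=1}^{r+1}\epsilon^k\varphi(y_1,\dots,\widehat{y_k},\dots,y_{r+1})\varphi(y_k,x_1,\dots,x_{r-1})\in N_F$ for all $x_i,y_j\in E$. An $F$-matroid of rank $r$ is a class $M=[\varphi]$ modulo multiplication by $F^\times$; its underlying matroid $\underline M$ has as bases the sets $\{x_1,\dots,x_r\}$ with $\varphi(x_1,\dots,x_r)\neq0$. Minors: for $A\subseteq E$, let $\ell$ be the rank of $A$ in $\underline M$ and $\{a_1,\dots,a_\ell\}$ a maximal independent subset of $A$; $M/A$ is the $F$-matroid on $E\setminus A$ represented by $(\varphi/A)(x_1,\dots,x_{r-\ell})=\varphi(x_1,\dots,x_{r-\ell},a_1,\dots,a_\ell)$.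 Let $k$ be the rank of $E\setminus A$ in $\underline M$ and $a_1,\dots,a_{r-k}\in A$ a basis of $\underline M/(E\setminus A)$; $M\backslash A$ is the $F$-matroid on $E\setminus A$ represented by $(\varphi\backslash A)(x_1,\dots,x_k)=\varphi(x_1,\dots,x_k,a_1,\dots,a_{r-k})$. These are well defined up to $F^\times$. If $M=[\mu]$, $N=[\nu]$ have ranks $r,w$, then $N\twoheadrightarrow M$ means $\sum_{k=1}^{w+1}\epsilon^k\nu(y_1,\dots,\widehat{y_k},\dots,y_{w+1})\mu(y_k,x_1,\dots,x_{r-1})\in N_F$ for all $y_1,\dots,y_{w+1},x_1,\dots,x_{r-1}$ in the ground set. A flag $F$-matroid is a sequence $(M_1,\dots,M_s)$ of $F$-matroids on a common ground set with $M_j\twoheadrightarrow M_i$ for all $1\le i<j\le s$. *)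

theory Defs
  imports "HOL-Algebra.Group" "HOL-Library.Multiset"
begin

text \<open>
  Elements of \<open>\<nat>[F\<^sup>\<times>]\<close> are finite multisets of nonzero elements of \<open>F\<close>; the zero of
  \<open>\<nat>[F\<^sup>\<times>]\<close> is the empty multiset.
\<close>

record 'a tract = "'a monoid" +
  tzero :: 'a
  nullset :: "'a multiset set"

definition nonzero :: "('a, 'b) tract_scheme \<Rightarrow> 'a set"
  where "nonzero F = carrier F - {tzero F}"

locale tract = comm_monoid F for F (structure) +
  assumes zero_closed: "tzero F \<in> carrier F"
    and zero_absorb: "x \<in> carrier F \<Longrightarrow> tzero F \<otimes> x = tzero F"
    and nonzero_group: "group (F\<lparr>carrier := nonzero F\<rparr>)"
    and nullset_subset: "nullset F \<subseteq> {m. set_mset m \<subseteq> nonzero F}"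
    and zero_in_nullset: "{#} \<in> nullset F"
    and one_notin_nullset: "{#\<one>#} \<notin> nullset F"
    and ex1_epsilon: "\<exists>!e. e \<in> nonzero F \<and> {#\<one>, e#} \<in> nullset F"
    and nullset_mult: "\<lbrakk>g \<in> nonzero F; m \<in> nullset F\<rbrakk> \<Longrightarrow> {#g \<otimes> x. x \<in># m#} \<in> nullset F"

definition epsilon :: "('a, 'b) tract_scheme \<Rightarrow> 'a"
  where "epsilon F = (THE e. e \<in> nonzero F \<and> {#\<one>\<^bsub>F\<^esub>, e#} \<in> nullset F)"

definition tract_morphism ::
    "('a, 'b) tract_scheme \<Rightarrow> ('c, 'd) tract_scheme \<Rightarrow> ('a \<Rightarrow> 'c) \<Rightarrow> bool"
  where "tract_morphism F G h \<longleftrightarrow>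
    h \<in> hom F G \<and> h \<one>\<^bsub>F\<^esub> = \<one>\<^bsub>G\<^esub> \<and> h (tzero F) = tzero G \<and>
    (\<forall>m \<in> nullset F. image_mset h m \<in> nullset G)"

definition tract_involution :: "('a, 'b) tract_scheme \<Rightarrow> ('a \<Rightarrow> 'a) \<Rightarrow> bool"
  where "tract_involution F \<tau> \<longleftrightarrow>
    tract_morphism F F \<tau> \<and> (\<forall>x \<in> carrier F. \<tau> (\<tau> x) = x)"

text \<open>
  A formal sum of elements of \<open>F\<close>, viewed in \<open>\<nat>[F\<^sup>\<times>]\<close>: summands equal to the zero of \<open>F\<close>
  are dropped.
\<close>

definition formal_sum :: "('a, 'b) tract_scheme \<Rightarrow> 'a list \<Rightarrow> 'a multiset"
  where "formal_sum F ts = filter_mset (\<lambda>t. t \<noteq> tzero F) (mset ts)"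

definition tuples :: "'e set \<Rightarrow> nat \<Rightarrow> 'e list set"
  where "tuples E r = {xs. set xs \<subseteq> E \<and> length xs = r}"

text \<open>
  Positions in lists are counted from \<open>0\<close>, so \<open>ys ! k\<close> is the entry usually called
  \<open>y\<^bsub>k+1\<^esub>\<close> and its summand carries the sign \<open>\<epsilon>\<^bsup>k+1\<^esup>\<close>.
\<close>

definition gp_sum ::
    "('a, 'b) tract_scheme \<Rightarrow> ('e list \<Rightarrow> 'a) \<Rightarrow> ('e list \<Rightarrow> 'a) \<Rightarrow> 'e list \<Rightarrow> 'e list \<Rightarrow> 'a multiset"
  where "gp_sum F \<nu> \<mu> ys xs =
    formal_sum F
      (map (\<lambda>k. epsilon F [^]\<^bsub>F\<^esub> Suc k \<otimes>\<^bsub>F\<^esub> \<nu> (take k ys @ drop (Suc k) ys) \<otimes>\<^bsub>F\<^esub> \<mu> (ys ! k # xs))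
        [0..<length ys])"

text \<open>
  The tuple \<open>xs = (x\<^sub>1, \<dots>, x\<^bsub>r-1\<^esub>)\<close> is constrained by \<open>Suc (length xs) = r\<close>, so that for
  \<open>r = 0\<close> there is no such tuple and the condition is vacuous.
\<close>

definition gp_relations ::
    "('a, 'b) tract_scheme \<Rightarrow> 'e set \<Rightarrow> nat \<Rightarrow> ('e list \<Rightarrow> 'a) \<Rightarrow> nat \<Rightarrow> ('e list \<Rightarrow> 'a) \<Rightarrow> bool"
  where "gp_relations F E w \<nu> r \<mu> \<longleftrightarrow>
    (\<forall>ys xs. set ys \<subseteq> E \<and> length ys = Suc w \<and> set xs \<subseteq> E \<and> Suc (length xs) = r \<longrightarrow>
      gp_sum F \<nu> \<mu> ys xs \<in> nullset F)"

definition alternating ::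
    "('a, 'b) tract_scheme \<Rightarrow> 'e set \<Rightarrow> nat \<Rightarrow> ('e list \<Rightarrow> 'a) \<Rightarrow> bool"
  where "alternating F E r \<phi> \<longleftrightarrow>
    (\<forall>xs \<in> tuples E r. \<forall>i j. i < j \<and> j < r \<longrightarrow>
      \<phi> (xs[i := xs ! j, j := xs ! i]) = epsilon F \<otimes>\<^bsub>F\<^esub> \<phi> xs \<and>
      (xs ! i = xs ! j \<longrightarrow> \<phi> xs = tzero F))"

definition GP_function ::
    "('a, 'b) tract_scheme \<Rightarrow> 'e set \<Rightarrow> nat \<Rightarrow> ('e list \<Rightarrow> 'a) \<Rightarrow> bool"
  where "GP_function F E r \<phi> \<longleftrightarrow>
    \<phi> \<in> tuples E r \<rightarrow> carrier F \<and>
    (\<exists>xs \<in> tuples E r. \<phi> xs \<noteq> tzero F) \<and>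
    alternating F E r \<phi> \<and>
    gp_relations F E r \<phi> r \<phi>"

text \<open>
  The class \<open>[\<phi>]\<close> modulo \<open>F\<^sup>\<times>\<close>. Its members are restricted to \<open>E\<^sup>r\<close>, so that equality of
  classes does not depend on values outside \<open>E\<^sup>r\<close>.
\<close>

definition gp_class ::
    "('a, 'b) tract_scheme \<Rightarrow> 'e set \<Rightarrow> nat \<Rightarrow> ('e list \<Rightarrow> 'a) \<Rightarrow> ('e list \<Rightarrow> 'a) set"
  where "gp_class F E r \<phi> = {\<lambda>xs \<in> tuples E r. c \<otimes>\<^bsub>F\<^esub> \<phi> xs | c. c \<in> nonzero F}"

record ('e, 'a) fmatroid =
  ground :: "'e set"
  mrank :: nat
  gpfuns :: "('e list \<Rightarrow> 'a) set"

definition F_matroid :: "('a, 'b) tract_scheme \<Rightarrow> ('e, 'a) fmatroid \<Rightarrow> bool"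
  where "F_matroid F M \<longleftrightarrow>
    (\<exists>\<phi>. GP_function F (ground M) (mrank M) \<phi> \<and>
         gpfuns M = gp_class F (ground M) (mrank M) \<phi>)"

definition bases :: "('a, 'b) tract_scheme \<Rightarrow> ('e, 'a) fmatroid \<Rightarrow> 'e set set"
  where "bases F M =
    {set xs | xs \<phi>. \<phi> \<in> gpfuns M \<and> xs \<in> tuples (ground M) (mrank M) \<and> \<phi> xs \<noteq> tzero F}"

text \<open>Ordinary matroids are given by their families \<open>\<B>\<close> of bases.\<close>

definition indep :: "'e set set \<Rightarrow> 'e set \<Rightarrow> bool"
  where "indep \<B> X \<longleftrightarrow> (\<exists>B \<in> \<B>. X \<subseteq> B)"

definition max_indep_in :: "'e set set \<Rightarrow> 'e set \<Rightarrow> 'e set \<Rightarrow> bool"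
  where "max_indep_in \<B> A X \<longleftrightarrow>
    X \<subseteq> A \<and> indep \<B> X \<and> (\<forall>Y. X \<subseteq> Y \<and> Y \<subseteq> A \<and> indep \<B> Y \<longrightarrow> Y = X)"

definition rank_of :: "'e set set \<Rightarrow> 'e set \<Rightarrow> nat"
  where "rank_of \<B> A = Max {card X | X. X \<subseteq> A \<and> indep \<B> X}"

definition contract_bases :: "'e set set \<Rightarrow> 'e set \<Rightarrow> 'e set set"
  where "contract_bases \<B> C = {X. X \<inter> C = {} \<and> (\<exists>Z. max_indep_in \<B> C Z \<and> X \<union> Z \<in> \<B>)}"

text \<open>
  The functions \<open>\<phi>/A\<close> and \<open>\<phi>\A\<close> depend on the choice of \<open>as = (a\<^sub>1, a\<^sub>2, \<dots>)\<close> and of the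
  representative \<open>\<phi>\<close> only up to \<open>F\<^sup>\<times>\<close>, so the class of the minor is the set of the functions
  arising from all these choices.
\<close>

definition contraction ::
    "('a, 'b) tract_scheme \<Rightarrow> ('e, 'a) fmatroid \<Rightarrow> 'e set \<Rightarrow> ('e, 'a) fmatroid"
  where "contraction F M A =
    (let E' = ground M - A; r' = mrank M - rank_of (bases F M) A in
      \<lparr>ground = E', mrank = r',
       gpfuns = {\<lambda>xs \<in> tuples E' r'. \<phi> (xs @ as) | \<phi> as.
         \<phi> \<in> gpfuns M \<and> distinct as \<and> max_indep_in (bases F M) A (set as)}\<rparr>)"

definition deletion ::
    "('a, 'b) tract_scheme \<Rightarrow> ('e, 'a) fmatroid \<Rightarrow> 'e set \<Rightarrow> ('e, 'a) fmatroid"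
  where "deletion F M A =
    (let E' = ground M - A; k = rank_of (bases F M) E' in
      \<lparr>ground = E', mrank = k,
       gpfuns = {\<lambda>xs \<in> tuples E' k. \<phi> (xs @ as) | \<phi> as.
         \<phi> \<in> gpfuns M \<and> distinct as \<and> set as \<in> contract_bases (bases F M) E'}\<rparr>)"

definition quotient ::
    "('a, 'b) tract_scheme \<Rightarrow> ('e, 'a) fmatroid \<Rightarrow> ('e, 'a) fmatroid \<Rightarrow> bool"
  where "quotient F N M \<longleftrightarrow> ground N = ground M \<and>
    (\<forall>\<nu> \<in> gpfuns N. \<forall>\<mu> \<in> gpfuns M. gp_relations F (ground M) (mrank N) \<nu> (mrank M) \<mu>)"

definition flag_F_matroid ::
    "('a, 'b) tract_scheme \<Rightarrow> 'e set \<Rightarrow> ('e, 'a) fmatroid list \<Rightarrow> bool"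
  where "flag_F_matroid F E Ms \<longleftrightarrow>
    (\<forall>M \<in> set Ms. F_matroid F M \<and> ground M = E) \<and>
    (\<forall>i j. i < j \<and> j < length Ms \<longrightarrow> quotient F (Ms ! j) (Ms ! i))"

end

theory Submission
  imports Defs
begin

text \<open>
  Deletion and contraction both freeze trailing arguments of a GP function. Let \<open>bs\<close> and \<open>as\<close> be
  the frozen tuples for \<open>\<nu>\<close> and \<open>\<mu>\<close>. The relation between the minors at \<open>(ys, xs)\<close> is the relation
  between \<open>\<nu>\<close> and \<open>\<mu>\<close> at \<open>(ys @ bs, xs @ as)\<close> without the terms that omit an entry \<open>b\<close> of \<open>bs\<close>,
  and these terms are zero: under deletion \<open>ys\<close> is too long to be independent in the
  restriction of \<open>N\<close>, and under contraction \<open>b\<close> lies in the contracted set, of which \<open>as\<close> is a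
  maximal independent subset in \<open>M\<close>.

  The minors of a single matroid are well defined because maximal independent subsets are
  connected by exchanges of one element, and along such an exchange a GP relation with only two
  nonzero terms shows that the two functions are proportional.
\<close>

section \<open>Matroids given by their bases: independence, rank and exchange\<close>

locale basis_system =
  fixes E :: "'e set" and r :: nat and \<B> :: "'e set set"
  assumes finite_ground: "finite E"
    and bases_nonempty: "\<B> \<noteq> {}"
    and basis_subset: "B \<in> \<B> \<Longrightarrow> B \<subseteq> E"
    and basis_card: "B \<in> \<B> \<Longrightarrow> card B = r"
    and exchange: "\<lbrakk>B \<in> \<B>; C \<in> \<B>; e \<in> B - C\<rbrakk> \<Longrightarrow> \<exists>f \<in> C - B. insert f (B - {e}) \<in> \<B>"
begin

lemma basis_finite: "B \<in> \<B> \<Longrightarrow> finite B"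
  using basis_subset finite_ground finite_subset by metis

lemma indep_subset: "indep \<B> X \<Longrightarrow> X \<subseteq> E"
  unfolding indep_def using basis_subset by blast

lemma indep_finite: "indep \<B> X \<Longrightarrow> finite X"
  using indep_subset finite_ground finite_subset by metis

lemma indep_mono: "\<lbrakk>indep \<B> Y; X \<subseteq> Y\<rbrakk> \<Longrightarrow> indep \<B> X"
  unfolding indep_def by blast

lemma indep_empty: "indep \<B> {}"
  unfolding indep_def using bases_nonempty by blast

text \<open>Start from any basis above \<open>X\<close> and exchange an element outside
  \<open>X \<union> C\<close> for an element of \<open>C\<close>. The part outside
  \<open>X \<union> C\<close> shrinks each time while \<open>X\<close> stays inside, so the process
  ends in a basis of the required form.\<close>

lemma indep_extend_within_basis:
  assumes "indep \<B> X" "C \<in> \<B>"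
  obtains B where "B \<in> \<B>" "X \<subseteq> B" "B \<subseteq> X \<union> C"
proof -
  obtain B0 where B0: "B0 \<in> \<B>" "X \<subseteq> B0"
    using assms(1) by (auto simp: indep_def)
  have "\<exists>B \<in> \<B>. X \<subseteq> B \<and> B \<subseteq> X \<union> C" if "B \<in> \<B>" "X \<subseteq> B" for B
    using that
  proof (induction "card (B - (X \<union> C))" arbitrary: B rule: less_induct)
    case less
    have fin: "finite B" using less.prems(1) by (rule basis_finite)
    show ?case
    proof (cases "B \<subseteq> X \<union> C")
      case False
      then obtain b where b: "b \<in> B" "b \<notin> X" "b \<notin> C" by auto
      then obtain f where f: "f \<in> C - B" "insert f (B - {b}) \<in> \<B>"
        using exchange[OF less.prems(1) assms(2), of b] by auto
      have "insert f (B - {b}) - (X \<union> C) = B - (X \<union> C) - {b}"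
        using f(1) by auto
      then have "card (insert f (B - {b}) - (X \<union> C)) < card (B - (X \<union> C))"
        using fin b by (metis DiffI UnE card_Diff1_less finite_Diff)
      moreover have "X \<subseteq> insert f (B - {b})" using b(2) less.prems(2) by auto
      ultimately show ?thesis using less.hyps[OF _ f(2)] by simp
    qed (use less.prems in auto)
  qed
  then show ?thesis using B0 that by blast
qed

text \<open>Take a basis \<open>C\<close> above \<open>Y\<close> and extend \<open>X\<close> to a
  basis \<open>B\<close> inside \<open>X \<union> C\<close>. As \<open>B\<close> and
  \<open>C\<close> have the same size, \<open>B - X\<close> is larger than \<open>C - Y\<close>. So
  some element of \<open>B - X\<close>, which lies in \<open>C\<close>, must lie in
  \<open>Y\<close>.\<close>

lemma augment:
  assumes X: "indep \<B> X" and Y: "indep \<B> Y" and "card X < card Y"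
  obtains y where "y \<in> Y - X" "indep \<B> (insert y X)"
proof -
  obtain C where C: "C \<in> \<B>" "Y \<subseteq> C" using Y by (auto simp: indep_def)
  obtain B where B: "B \<in> \<B>" "X \<subseteq> B" "B \<subseteq> X \<union> C"
    using indep_extend_within_basis[OF X C(1)] by blast
  have fin: "finite B" "finite C" "finite X" "finite Y"
    using B(1) C(1) indep_finite[OF X] indep_finite[OF Y] basis_finite by auto
  have "card (C - Y) < card (B - X)"
    using assms(3) basis_card[OF B(1)] basis_card[OF C(1)]
      card_mono[OF fin(2) C(2)] card_mono[OF fin(1) B(2)]
      card_Diff_subset[OF fin(4) C(2)] card_Diff_subset[OF fin(3) B(2)] by linarith
  then have "\<not> B - X \<subseteq> C - Y"
    using fin card_mono[of "C - Y" "B - X"] by auto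
  then obtain b where "b \<in> B - X" "b \<in> Y" using B by blast
  then show ?thesis using that[of b] B by (auto simp: indep_def)
qed

lemma max_indep_inD:
  assumes "max_indep_in \<B> A X"
  shows "X \<subseteq> A" "indep \<B> X" "finite X" "X \<subseteq> E"
  using assms indep_finite indep_subset unfolding max_indep_in_def by auto

lemma indep_card_le_max_indep:
  assumes "max_indep_in \<B> A X" "indep \<B> Y" "Y \<subseteq> A"
  shows "card Y \<le> card X"
proof (rule ccontr)
  assume "\<not> ?thesis"
  then obtain y where y: "y \<in> Y - X" "indep \<B> (insert y X)"
    using augment[of X Y] assms max_indep_inD by (metis not_le)
  then have "insert y X = X" using assms unfolding max_indep_in_def by blast
  then show False using y by blast
qed

lemma rank_of_max_indep:
  assumes "max_indep_in \<B> A X"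
  shows "rank_of \<B> A = card X"
proof -
  \<comment> \<open>\<open>Max\<close> needs a finite set. The bound by \<open>card X\<close>
    provides this even when \<open>A\<close> itself is infinite.\<close>
  have "finite {card Y | Y. Y \<subseteq> A \<and> indep \<B> Y}"
    using indep_card_le_max_indep[OF assms] by (intro finite_subset[OF _ finite_atMost[of "card X"]]) auto
  then show ?thesis
    unfolding rank_of_def
  proof (rule Max_eqI)
    show "card X \<in> {card Y | Y. Y \<subseteq> A \<and> indep \<B> Y}"
      using max_indep_inD(1,2)[OF assms] by blast
  qed (use indep_card_le_max_indep[OF assms] in blast)
qed

lemma max_indep_exists:
  assumes "indep \<B> X" "X \<subseteq> A"
  obtains Z where "max_indep_in \<B> A Z" "X \<subseteq> Z"
proof -
  have "finite {Y. X \<subseteq> Y \<and> Y \<subseteq> A \<and> indep \<B> Y}"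
    by (rule finite_subset[of _ "Pow E"]) (auto simp: finite_ground dest: indep_subset)
  then obtain Z where "Z \<in> {Y. X \<subseteq> Y \<and> Y \<subseteq> A \<and> indep \<B> Y}"
    "\<forall>Y \<in> {Y. X \<subseteq> Y \<and> Y \<subseteq> A \<and> indep \<B> Y}. Z \<subseteq> Y \<longrightarrow> Z = Y"
    using finite_has_maximal2[of "{Y. X \<subseteq> Y \<and> Y \<subseteq> A \<and> indep \<B> Y}" X] assms by blast
  then have "max_indep_in \<B> A Z" "X \<subseteq> Z" unfolding max_indep_in_def by auto
  then show ?thesis using that by blast
qed

lemma indep_card_le_rank_of:
  assumes "indep \<B> X" "X \<subseteq> A"
  shows "card X \<le> rank_of \<B> A"
  by (metis assms indep_card_le_max_indep max_indep_exists rank_of_max_indep)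

lemma max_indep_iff_card:
  "max_indep_in \<B> A X \<longleftrightarrow> X \<subseteq> A \<and> indep \<B> X \<and> card X = rank_of \<B> A"
proof
  assume "X \<subseteq> A \<and> indep \<B> X \<and> card X = rank_of \<B> A"
  then show "max_indep_in \<B> A X"
    unfolding max_indep_in_def
    by (metis indep_card_le_rank_of card_seteq indep_finite)
qed (use max_indep_inD rank_of_max_indep in auto)

text \<open>Augment \<open>X - {e}\<close> from the larger set \<open>Y\<close>. The new element
  differs from \<open>e\<close> because \<open>e\<close> is not in \<open>Y\<close>, and the
  restored cardinality gives maximality.\<close>

lemma max_indep_exchange:
  assumes X: "max_indep_in \<B> A X" and Y: "max_indep_in \<B> A Y" and e: "e \<in> X - Y"
  obtains f where "f \<in> Y - X" "max_indep_in \<B> A (insert f (X - {e}))"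
proof -
  have "card (X - {e}) < card Y"
    using e X Y max_indep_inD(3)[OF X] card_Diff1_less[of X e] by (auto simp: max_indep_iff_card)
  then obtain f where f: "f \<in> Y - (X - {e})" "indep \<B> (insert f (X - {e}))"
    using augment[of "X - {e}" Y] X Y by (metis Diff_subset indep_mono max_indep_inD(2))
  then have "f \<in> Y - X" using e by blast
  moreover have "card (insert f (X - {e})) = card X"
    using max_indep_inD(3)[OF X] e \<open>f \<in> Y - X\<close> card_Suc_Diff1[of X e] by simp
  ultimately show ?thesis
    using that f X Y max_indep_iff_card by (smt (verit) Diff_subset insert_subset max_indep_inD(1) DiffD1 subset_eq)
qed

text \<open>A basis above \<open>insert b X\<close> would make this set independent in
  \<open>A\<close>, against maximality of \<open>X\<close>. This is the source of the vanishing
  terms in the quotient relation of contractions.\<close>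

lemma max_indep_insert_not_basis:
  assumes "max_indep_in \<B> A X" "b \<in> A - X" "insert b X \<subseteq> B"
  shows "B \<notin> \<B>"
proof
  assume "B \<in> \<B>"
  then have "indep \<B> (insert b X)" using assms(3) by (auto simp: indep_def)
  moreover have "insert b X \<subseteq> A" using assms(2) max_indep_inD(1)[OF assms(1)] by simp
  ultimately have "insert b X = X"
    using assms(1) unfolding max_indep_in_def by (metis subset_insertI)
  then show False using assms(2) by blast
qed

lemma contract_bases_card:
  assumes "X \<in> contract_bases \<B> S"
  shows "X \<subseteq> E" "rank_of \<B> S + card X = r"
proof -
  obtain Z where Z: "X \<inter> S = {}" "max_indep_in \<B> S Z" "X \<union> Z \<in> \<B>"
    using assms by (auto simp: contract_bases_def)
  show "X \<subseteq> E" using basis_subset[OF Z(3)] by simp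
  have "X \<inter> Z = {}" using Z(1) max_indep_inD(1)[OF Z(2)] by auto
  then have "card (X \<union> Z) = card X + card Z"
    using basis_finite[OF Z(3)] by (simp add: card_Un_disjoint)
  then show "rank_of \<B> S + card X = r"
    using basis_card[OF Z(3)] rank_of_max_indep[OF Z(2)] by simp
qed

text \<open>The truncated subtraction is a genuine one, since \<open>X\<close> lies in a basis and
  so the rank of \<open>A\<close> is at most \<open>r\<close>.\<close>

lemma corank_plus_card_max_indep:
  assumes "max_indep_in \<B> A X"
  shows "r - rank_of \<B> A + card X = r"
proof -
  obtain B where B: "B \<in> \<B>" "X \<subseteq> B" using max_indep_inD(2)[OF assms] by (auto simp: indep_def)
  then have "card X \<le> r" using card_mono[OF basis_finite[OF B(1)] B(2)] basis_card by simp
  then show ?thesis using rank_of_max_indep[OF assms] by simp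
qed

text \<open>Any basis \<open>B\<close> above \<open>X\<close> meets \<open>A\<close> in an
  independent set containing \<open>X\<close>, hence exactly in \<open>X\<close>; the witness is
  \<open>B - A\<close>.\<close>

lemma max_indep_complement_exists:
  assumes "max_indep_in \<B> A X"
  obtains Z where "Z \<inter> A = {}" "Z \<union> X \<in> \<B>"
proof -
  obtain B where B: "B \<in> \<B>" "X \<subseteq> B" using max_indep_inD[OF assms] by (auto simp: indep_def)
  have "indep \<B> (B \<inter> A)" using B by (auto simp: indep_def)
  moreover have "X \<subseteq> B \<inter> A" using B(2) max_indep_inD(1)[OF assms] by simp
  ultimately have "B \<inter> A = X"
    using assms unfolding max_indep_in_def by (metis inf_le2)
  then show ?thesis using that[of "B - A"] B by (metis Diff_disjoint Int_commute Un_Diff_Int)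
qed

end

section \<open>Arithmetic in tracts and null sums\<close>

context tract
begin

abbreviation zero (\<open>\<zero>\<^sub>F\<close>) where "\<zero>\<^sub>F \<equiv> tzero F"

lemma nonzero_closed: "a \<in> nonzero F \<Longrightarrow> a \<in> carrier F"
  by (simp add: nonzero_def)

lemma nonzeroI: "\<lbrakk>a \<in> carrier F; a \<noteq> \<zero>\<^sub>F\<rbrakk> \<Longrightarrow> a \<in> nonzero F"
  by (simp add: nonzero_def)

lemma one_nonzero: "\<one> \<in> nonzero F"
  using monoid.one_closed[OF group.is_monoid[OF nonzero_group]] by simp

lemma mult_nonzero: "\<lbrakk>a \<in> nonzero F; b \<in> nonzero F\<rbrakk> \<Longrightarrow> a \<otimes> b \<in> nonzero F"
  using monoid.m_closed[OF group.is_monoid[OF nonzero_group]] by simp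

lemma pow_nonzero: "a \<in> nonzero F \<Longrightarrow> a [^] (n::nat) \<in> nonzero F"
  by (induction n) (auto simp: one_nonzero mult_nonzero)

lemma nonzero_inverse:
  assumes "a \<in> nonzero F"
  obtains b where "b \<in> nonzero F" "b \<otimes> a = \<one>"
  using group.l_inv_ex[OF nonzero_group] assms by auto

lemma absorb_right: "a \<in> carrier F \<Longrightarrow> a \<otimes> \<zero>\<^sub>F = \<zero>\<^sub>F"
  using m_comm zero_absorb zero_closed by simp

lemma nonzero_cancel:
  assumes "a \<in> nonzero F" "x \<in> carrier F" "y \<in> carrier F" "a \<otimes> x = a \<otimes> y"
  shows "x = y"
proof -
  obtain b where b: "b \<in> nonzero F" "b \<otimes> a = \<one>" using nonzero_inverse assms(1) by blast
  have "b \<otimes> a \<otimes> x = b \<otimes> a \<otimes> y"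
    using assms b(1) by (simp add: m_assoc nonzero_closed)
  then show ?thesis using assms(2,3) b(2) by simp
qed

lemma mult_eq_zero_iff:
  assumes "a \<in> carrier F" "b \<in> carrier F"
  shows "a \<otimes> b = \<zero>\<^sub>F \<longleftrightarrow> a = \<zero>\<^sub>F \<or> b = \<zero>\<^sub>F"
  using mult_nonzero[of a b] assms zero_absorb absorb_right by (auto simp: nonzero_def)

lemma triple_product_zero:
  "\<lbrakk>a \<in> carrier F; b \<in> carrier F; c \<in> carrier F; b = \<zero>\<^sub>F \<or> c = \<zero>\<^sub>F\<rbrakk> \<Longrightarrow> a \<otimes> b \<otimes> c = \<zero>\<^sub>F"
  by (auto simp: absorb_right zero_absorb)

lemma epsilon_props: "epsilon F \<in> nonzero F" "{#\<one>, epsilon F#} \<in> nullset F"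
  using theI'[OF ex1_epsilon] unfolding epsilon_def by auto

lemma epsilon_unique: "\<lbrakk>e \<in> nonzero F; {#\<one>, e#} \<in> nullset F\<rbrakk> \<Longrightarrow> e = epsilon F"
  using ex1_epsilon epsilon_props by blast

lemma eps_pow_nonzero: "epsilon F [^] (n::nat) \<in> nonzero F"
  by (simp add: epsilon_props pow_nonzero)

lemma eps_pow_closed: "epsilon F [^] (n::nat) \<in> carrier F"
  by (simp add: eps_pow_nonzero nonzero_closed)

lemma eps_closed: "epsilon F \<in> carrier F"
  by (simp add: epsilon_props nonzero_closed)

text \<open>Scaling by the inverse of \<open>a\<close> would put \<open>{#\<one>#}\<close> in the
  nullset.\<close>

lemma singleton_notin_nullset:
  assumes "a \<in> nonzero F" shows "{#a#} \<notin> nullset F"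
proof
  assume "{#a#} \<in> nullset F"
  moreover obtain b where "b \<in> nonzero F" "b \<otimes> a = \<one>" using nonzero_inverse assms by blast
  ultimately show False using nullset_mult[of b "{#a#}"] one_notin_nullset by simp
qed

text \<open>If one summand is zero, so is the other, because no nonzero singleton is null. Otherwise
  scaling by the inverse of \<open>a\<close> gives a null sum of \<open>\<one>\<close> and one
  further term, which uniqueness identifies as \<open>epsilon F\<close>.\<close>

lemma two_term_null:
  assumes "a \<in> carrier F" "b \<in> carrier F" "formal_sum F [a, b] \<in> nullset F"
  shows "b = epsilon F \<otimes> a"
proof (cases "a = \<zero>\<^sub>F")
  case True
  then have "b = \<zero>\<^sub>F"
    using assms singleton_notin_nullset[of b] by (auto simp: formal_sum_def nonzero_def split: if_splits)
  then show ?thesis using True eps_closed absorb_right by simp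
next
  case False
  then have a: "a \<in> nonzero F" using assms by (simp add: nonzero_def)
  then have b: "b \<in> nonzero F"
    using assms singleton_notin_nullset[of a] by (auto simp: formal_sum_def nonzero_def split: if_splits)
  obtain c where c: "c \<in> nonzero F" "c \<otimes> a = \<one>" using nonzero_inverse a by blast
  have "{#a, b#} \<in> nullset F" using a b assms by (auto simp: formal_sum_def nonzero_def)
  then have "{#\<one>, c \<otimes> b#} \<in> nullset F" using nullset_mult[OF c(1)] c(2) by fastforce
  then have "c \<otimes> b = epsilon F" using epsilon_unique mult_nonzero b c by blast
  then have "c \<otimes> b = c \<otimes> (epsilon F \<otimes> a)"
    using m_lcomm[of c "epsilon F" a] c a by (simp add: eps_closed nonzero_closed)
  then show ?thesis using nonzero_cancel c a b eps_closed nonzero_closed by (metis m_closed)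
qed

text \<open>Formal sums drop zeros, so for distinct index lists only the set of indices with nonzero
  term counts. This reduces a GP relation to its surviving terms.\<close>

lemma formal_sum_map_eq:
  assumes "set ks \<subseteq> set js" "distinct ks" "distinct js"
    and "\<And>k. k \<in> set js - set ks \<Longrightarrow> f k = \<zero>\<^sub>F"
  shows "formal_sum F (map f js) = formal_sum F (map f ks)"
proof -
  have *: "formal_sum F (map f ls) = image_mset f (mset_set {k \<in> set ls. f k \<noteq> \<zero>\<^sub>F})"
    if "distinct ls" for ls
  proof -
    have "mset ls = mset_set (set ls)" using that by (simp add: mset_set_set)
    then show ?thesis unfolding formal_sum_def by (simp add: filter_mset_image_mset)
  qed
  have "{k \<in> set js. f k \<noteq> \<zero>\<^sub>F} = {k \<in> set ks. f k \<noteq> \<zero>\<^sub>F}" using assms by auto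
  then show ?thesis using *[of js] *[of ks] assms by simp
qed

lemma formal_sum_append_zeros:
  assumes "\<And>t. t \<in> set us \<Longrightarrow> t = \<zero>\<^sub>F"
  shows "formal_sum F (ts @ us) = formal_sum F ts"
  using assms by (auto simp: formal_sum_def filter_mset_eq_conv)

end


section \<open>Grassmann-Pluecker functions and their underlying matroid\<close>

locale gp_fun = tract F for F (structure) +
  fixes E :: "'e set" and r :: nat and \<phi> :: "'e list \<Rightarrow> 'a"
  assumes finite_E: "finite E" and gp: "GP_function F E r \<phi>"
begin

lemma phi_closed: "\<lbrakk>set xs \<subseteq> E; length xs = r\<rbrakk> \<Longrightarrow> \<phi> xs \<in> carrier F"
  using gp by (auto simp: GP_function_def tuples_def)

lemma phi_distinct:
  assumes "set xs \<subseteq> E" "length xs = r" "\<phi> xs \<noteq> \<zero>\<^sub>F"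
  shows "distinct xs"
proof (rule ccontr)
  assume "\<not> distinct xs"
  then obtain i j where "i < j" "j < r" "xs ! i = xs ! j"
    using assms(2) by (metis distinct_conv_nth linorder_neqE_nat)
  then show False
    using gp assms unfolding GP_function_def alternating_def tuples_def by blast
qed

lemma phi_swap_adjacent:
  assumes "set (xs @ a # b # ys) \<subseteq> E" "length (xs @ a # b # ys) = r"
  shows "\<phi> (xs @ b # a # ys) = epsilon F \<otimes> \<phi> (xs @ a # b # ys)"
proof -
  have alt: "alternating F E r \<phi>" using gp by (simp add: GP_function_def)
  let ?zs = "xs @ a # b # ys"
  have "?zs \<in> tuples E r" using assms by (simp add: tuples_def)
  moreover have "length xs < Suc (length xs)" "Suc (length xs) < r" using assms by auto
  ultimately have "\<phi> (?zs[length xs := ?zs ! Suc (length xs), Suc (length xs) := ?zs ! length xs])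
    = epsilon F \<otimes> \<phi> ?zs"
    using alt unfolding alternating_def by blast
  moreover have "?zs[length xs := ?zs ! Suc (length xs), Suc (length xs) := ?zs ! length xs]
    = xs @ b # a # ys"
    by (simp add: nth_append list_update_append)
  ultimately show ?thesis by simp
qed

text \<open>The entry \<open>a\<close> passes the entries of \<open>us\<close> one at a time, each
  adjacent swap contributing one factor \<open>epsilon F\<close>. In the induction the passed
  entries join the fixed prefix \<open>xs\<close>.\<close>

lemma phi_move_front:
  assumes "set (xs @ us @ a # vs) \<subseteq> E" "length (xs @ us @ a # vs) = r"
  shows "\<phi> (xs @ us @ a # vs) = epsilon F [^] length us \<otimes> \<phi> (xs @ a # us @ vs)"
  using assms
proof (induction us arbitrary: xs)
  case Nil
  then show ?case using phi_closed[of "xs @ a # vs"] by simp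
next
  case (Cons b us)
  have "\<phi> (xs @ (b # us) @ a # vs) = epsilon F [^] length us \<otimes> \<phi> (xs @ b # a # us @ vs)"
    using Cons.IH[of "xs @ [b]"] Cons.prems by simp
  also have "\<phi> (xs @ b # a # us @ vs) = epsilon F \<otimes> \<phi> (xs @ a # b # us @ vs)"
    using phi_swap_adjacent[of xs a b "us @ vs"] Cons.prems by simp
  finally show ?case
    using phi_closed[of "xs @ a # b # us @ vs"] Cons.prems
    by (simp add: m_assoc eps_closed)
qed

lemma phi_swap_blocks:
  assumes "set (xs @ us @ vs) \<subseteq> E" "length (xs @ us @ vs) = r"
  shows "\<phi> (xs @ us @ vs) = epsilon F [^] (length us * length vs) \<otimes> \<phi> (xs @ vs @ us)"
  using assms
proof (induction vs arbitrary: xs)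
  case Nil
  then show ?case using phi_closed[of "xs @ us"] by simp
next
  case (Cons a vs)
  have "\<phi> (xs @ us @ a # vs) = epsilon F [^] length us \<otimes> \<phi> (xs @ a # us @ vs)"
    using phi_move_front Cons.prems by simp
  also have "\<phi> (xs @ a # us @ vs)
      = epsilon F [^] (length us * length vs) \<otimes> \<phi> (xs @ a # vs @ us)"
    using Cons.IH[of "xs @ [a]"] Cons.prems by simp
  finally show ?case
    using phi_closed[of "xs @ a # vs @ us"] Cons.prems
    by (simp add: eps_closed nat_pow_mult flip: m_assoc)
qed

text \<open>The exponent \<open>n\<close> is chosen before the prefix \<open>xs\<close>: one sign
  serves all prefixes, which is what makes permuted frozen tuples proportional.\<close>

lemma phi_permute:
  assumes "mset ys = mset ys'" "set ys \<subseteq> E"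
  shows "\<exists>n::nat. \<forall>xs. set xs \<subseteq> E \<and> length xs + length ys = r \<longrightarrow>
    \<phi> (xs @ ys') = epsilon F [^] n \<otimes> \<phi> (xs @ ys)"
  using assms
proof (induction ys arbitrary: ys')
  case Nil
  then show ?case using phi_closed by (intro exI[of _ "0::nat"]) auto
next
  case (Cons a ys)
  then have "a \<in> set ys'" by (metis list.set_intros(1) set_mset_mset)
  then obtain us vs where ys': "ys' = us @ a # vs" by (metis split_list)
  then have m: "mset ys = mset (us @ vs)" using Cons.prems by simp
  then have sl: "set ys = set (us @ vs)" "length ys = length (us @ vs)"
    by (metis set_mset_mset, metis size_mset)
  obtain n :: nat where n: "\<forall>xs. set xs \<subseteq> E \<and> length xs + length ys = r \<longrightarrow>
    \<phi> (xs @ us @ vs) = epsilon F [^] n \<otimes> \<phi> (xs @ ys)"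
    using Cons.IH[OF m] Cons.prems by auto
  have "\<phi> (xs @ ys') = epsilon F [^] (length us + n) \<otimes> \<phi> (xs @ a # ys)"
    if xs: "set xs \<subseteq> E" "length xs + length (a # ys) = r" for xs
  proof -
    have "\<phi> (xs @ ys') = epsilon F [^] length us \<otimes> \<phi> (xs @ a # us @ vs)"
      unfolding ys' using xs Cons.prems sl by (intro phi_move_front) auto
    also have "\<phi> (xs @ a # us @ vs) = epsilon F [^] n \<otimes> \<phi> (xs @ a # ys)"
      using n[rule_format, of "xs @ [a]"] xs Cons.prems by simp
    finally show ?thesis
      using phi_closed[of "xs @ a # ys"] xs Cons.prems
      by (simp add: eps_closed nat_pow_mult flip: m_assoc)
  qed
  then show ?case by blast
qed

lemma phi_permute_nonzero:
  assumes "mset ys = mset ys'" "set ys \<subseteq> E" "length ys = r" "\<phi> ys \<noteq> \<zero>\<^sub>F"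
  shows "\<phi> ys' \<noteq> \<zero>\<^sub>F"
proof -
  obtain n :: nat where "\<phi> ys' = epsilon F [^] n \<otimes> \<phi> ys"
    using phi_permute[OF assms(1,2)] assms(3) by (metis append_Nil add_0 empty_subsetI list.set(1) list.size(3))
  then show ?thesis
    using mult_nonzero[OF eps_pow_nonzero, of "\<phi> ys"] phi_closed[of ys] assms
    by (simp add: nonzero_def)
qed

text \<open>The support of one representative. Nonzero scalars preserve the support, so this family
  is later identified with \<open>bases F M\<close>.\<close>

definition base_sets :: "'e set set"
  where "base_sets = {set xs | xs. xs \<in> tuples E r \<and> \<phi> xs \<noteq> \<zero>\<^sub>F}"

lemma base_setsI: "\<lbrakk>set xs \<subseteq> E; length xs = r; \<phi> xs \<noteq> \<zero>\<^sub>F\<rbrakk> \<Longrightarrow> set xs \<in> base_sets"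
  by (auto simp: base_sets_def tuples_def)

text \<open>Some tuple with the same entries has a nonzero value and is therefore distinct, so
  \<open>xs\<close> is a permutation of it and its value differs by a power of
  \<open>epsilon F\<close>.\<close>

lemma base_sets_imp_nonzero:
  assumes "distinct xs" "set xs \<in> base_sets"
  shows "set xs \<subseteq> E" "length xs = r" "\<phi> xs \<noteq> \<zero>\<^sub>F"
proof -
  obtain zs where zs: "set zs \<subseteq> E" "length zs = r" "\<phi> zs \<noteq> \<zero>\<^sub>F" "set xs = set zs"
    using assms(2) by (auto simp: base_sets_def tuples_def)
  then have m: "mset zs = mset xs"
    using assms(1) phi_distinct by (simp add: set_eq_iff_mset_eq_distinct)
  show "set xs \<subseteq> E" "length xs = r" "\<phi> xs \<noteq> \<zero>\<^sub>F"
    using zs m phi_permute_nonzero[OF m] mset_eq_length[OF m] by auto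
qed

text \<open>Enumerate \<open>B - {e}\<close> by \<open>zs\<close> and \<open>C\<close> by
  \<open>ys\<close>, and use the GP relation at \<open>e # ys\<close> and \<open>zs\<close>. The
  term omitting \<open>e\<close> is nonzero, so another term is nonzero as well; it puts some entry
  of \<open>ys\<close> in front of \<open>zs\<close>, and this entry replaces
  \<open>e\<close>.\<close>

lemma base_sets_exchange:
  assumes "B \<in> base_sets" "C \<in> base_sets" "e \<in> B - C"
  shows "\<exists>f \<in> C - B. insert f (B - {e}) \<in> base_sets"
proof -
  have finB: "finite B" using assms(1) by (auto simp: base_sets_def)
  obtain zs where zs: "set zs = B - {e}" "distinct zs"
    using finite_distinct_list[of "B - {e}"] finB by auto
  then have ez: "distinct (e # zs)" "set (e # zs) = B" using assms(3) by auto
  obtain ys where ys: "set ys \<subseteq> E" "length ys = r" "\<phi> ys \<noteq> \<zero>\<^sub>F" "set ys = C"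
    using assms(2) by (auto simp: base_sets_def tuples_def)
  have nz: "set (e # zs) \<subseteq> E" "length (e # zs) = r" "\<phi> (e # zs) \<noteq> \<zero>\<^sub>F"
    using base_sets_imp_nonzero[OF ez(1)] ez(2) assms(1) by auto
  let ?Y = "e # ys"
  define f where "f = (\<lambda>k. epsilon F [^] Suc k \<otimes> \<phi> (take k ?Y @ drop (Suc k) ?Y) \<otimes> \<phi> (?Y ! k # zs))"
  have "gp_sum F \<phi> \<phi> ?Y zs \<in> nullset F"
    using gp nz ys by (simp add: GP_function_def gp_relations_def)
  then have null: "formal_sum F (map f [0..<length ?Y]) \<in> nullset F"
    by (simp only: gp_sum_def f_def)
  have f0: "f 0 \<in> nonzero F"
    unfolding f_def using ys nz phi_closed[of ys] phi_closed[of "e # zs"]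
    by (auto intro!: mult_nonzero simp: epsilon_props nonzeroI eps_closed)
  \<comment> \<open>Were \<open>f 0\<close> the only nonzero term, the null sum would be a nonzero
    singleton.\<close>
  have "\<exists>k < Suc (length ys). k \<noteq> 0 \<and> f k \<noteq> \<zero>\<^sub>F"
  proof (rule ccontr)
    assume "\<not> ?thesis"
    then have "formal_sum F (map f [0..<length ?Y]) = formal_sum F (map f [0])"
      by (intro formal_sum_map_eq) (auto simp del: upt_Suc)
    then have "{#f 0#} \<in> nullset F" using null f0 by (simp add: formal_sum_def nonzero_def)
    then show False using f0 singleton_notin_nullset by blast
  qed
  then obtain k' where k': "k' < Suc (length ys)" "k' \<noteq> 0" "f k' \<noteq> \<zero>\<^sub>F" by blast
  then obtain k where k: "k < length ys" "f (Suc k) \<noteq> \<zero>\<^sub>F"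
    by (cases k') auto
  let ?g = "ys ! k"
  have g: "?g \<in> C" "?g \<in> E" using ys k nth_mem by (blast, blast)
  have yk: "set (take k ys @ drop (Suc k) ys) \<subseteq> E"
    using ys(1) by (auto dest: in_set_takeD in_set_dropD)
  have c1: "\<phi> (e # take k ys @ drop (Suc k) ys) \<in> carrier F"
    using yk ys(2) nz(1) k(1) by (intro phi_closed) auto
  have "\<phi> (?g # zs) \<noteq> \<zero>\<^sub>F"
    using k(2) c1 absorb_right by (auto simp: f_def eps_closed)
  moreover have gz: "set (?g # zs) \<subseteq> E" "length (?g # zs) = r" using g nz by auto
  ultimately have "distinct (?g # zs)" "set (?g # zs) \<in> base_sets"
    using phi_distinct base_setsI by blast+
  \<comment> \<open>Distinctness keeps \<open>?g\<close> out of \<open>B - {e}\<close>; together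
    with \<open>?g \<noteq> e\<close> this places it outside \<open>B\<close>.\<close>
  moreover have "?g \<noteq> e" using g assms(3) by blast
  ultimately show ?thesis using g zs by (intro bexI[of _ ?g]) auto
qed

sublocale basis_system E r base_sets
proof
  show "base_sets \<noteq> {}" using gp by (auto simp: GP_function_def base_sets_def)
  show "card B = r" if "B \<in> base_sets" for B
    using that phi_distinct by (auto simp: base_sets_def tuples_def distinct_card)
qed (use finite_E base_sets_exchange in \<open>auto simp: base_sets_def tuples_def\<close>)

lemma phi_nonzero_indep:
  assumes "set xs \<subseteq> E" "length xs = r" "\<phi> xs \<noteq> \<zero>\<^sub>F" "Y \<subseteq> set xs"
  shows "indep base_sets Y"
  using base_setsI[OF assms(1-3)] assms(4) by (auto simp: indep_def)

text \<open>Supplies a point where the contracted function is nonzero, both to show that it is a GP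
  function and to read off scalars by division.\<close>

lemma max_indep_complement_tuple:
  assumes "distinct us" "max_indep_in base_sets A (set us)"
  obtains xs where "set xs \<subseteq> E - A" "length xs + length us = r" "\<phi> (xs @ us) \<noteq> \<zero>\<^sub>F"
proof -
  obtain Z where Z: "Z \<inter> A = {}" "Z \<union> set us \<in> base_sets"
    using max_indep_complement_exists[OF assms(2)] by blast
  have ZE: "Z \<subseteq> E" using basis_subset[OF Z(2)] by blast
  obtain xs where xs: "set xs = Z" "distinct xs"
    using finite_distinct_list finite_subset[OF ZE finite_E] by blast
  have "set us \<subseteq> A" using max_indep_inD[OF assms(2)] by blast
  then have "distinct (xs @ us)" "set (xs @ us) \<in> base_sets" using xs assms(1) Z by auto
  then have "length (xs @ us) = r" "\<phi> (xs @ us) \<noteq> \<zero>\<^sub>F" using base_sets_imp_nonzero by blast+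
  then show ?thesis using that[of xs] xs Z ZE by auto
qed

text \<open>In the GP relation for \<open>(x, c, c', u)\<close> and \<open>(x', u)\<close> only the two terms
  omitting \<open>c\<close> and \<open>c'\<close> survive, and a null sum of two terms determines their ratio.\<close>

lemma phi_exchange_identity:
  assumes E: "set (xs @ xs' @ c # c' # us) \<subseteq> E"
    and len: "length xs + Suc (length us) = r" "length xs' = length xs"
    and dep: "distinct (c # c' # us) \<Longrightarrow> \<not> indep base_sets (set (c # c' # us))"
  shows "\<phi> (xs @ c # us) \<otimes> \<phi> (xs' @ c' # us) = \<phi> (xs @ c' # us) \<otimes> \<phi> (xs' @ c # us)"
proof -
  let ?Y = "xs @ c # c' # us" and ?p = "length xs"
  define f where "f = (\<lambda>k. epsilon F [^] Suc k \<otimes> \<phi> (take k ?Y @ drop (Suc k) ?Y) \<otimes>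
    \<phi> (?Y ! k # xs' @ us))"
  have "gp_sum F \<phi> \<phi> ?Y (xs' @ us) \<in> nullset F"
    using gp E len by (simp add: GP_function_def gp_relations_def)
  then have null: "formal_sum F (map f [0..<length ?Y]) \<in> nullset F"
    by (simp only: gp_sum_def f_def)
  have zero: "f k = \<zero>\<^sub>F" if k: "k < length ?Y" "k \<noteq> ?p" "k \<noteq> Suc ?p" for k
  proof -
    let ?L = "take k ?Y @ drop (Suc k) ?Y" and ?R = "?Y ! k # xs' @ us"
    have "set ?L \<subseteq> set ?Y" by (auto dest: in_set_takeD in_set_dropD simp del: take_append drop_append)
    then have L: "set ?L \<subseteq> E" "length ?L = r" using E len k by auto
    have "?Y ! k \<in> set ?Y" using k(1) nth_mem by blast
    then have R: "set ?R \<subseteq> E" "length ?R = r" using E len by auto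
    \<comment> \<open>Before position \<open>?p\<close> the first factor still contains
      \<open>c\<close>, \<open>c'\<close> and all of \<open>us\<close>, which is repeated or
      dependent. After position \<open>Suc ?p\<close> the second factor repeats an entry of
      \<open>us\<close>.\<close>
    have "\<phi> ?L = \<zero>\<^sub>F \<or> \<phi> ?R = \<zero>\<^sub>F"
    proof (cases "k < ?p")
      case True
      then have L': "?L = (take k xs @ drop (Suc k) xs) @ c # c' # us" by simp
      then have "set (c # c' # us) \<subseteq> set ?L" by (metis Un_upper2 set_append)
      then show ?thesis
        using phi_nonzero_indep[OF L] phi_distinct[OF L] dep unfolding L' distinct_append by blast
    next
      case False
      then have "?Y ! k \<in> set us" using k by (auto simp: nth_append nth_Cons split: nat.splits)
      then show ?thesis using phi_distinct[OF R] by auto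
    qed
    then show ?thesis
      unfolding f_def by (intro triple_product_zero eps_pow_closed phi_closed L R)
  qed
  have "formal_sum F (map f [0..<length ?Y]) = formal_sum F (map f [?p, Suc ?p])"
    using zero by (intro formal_sum_map_eq) (auto simp del: upt_Suc)
  then have null2: "formal_sum F [f ?p, f (Suc ?p)] \<in> nullset F" using null by simp
  have cl: "\<phi> (xs @ c' # us) \<in> carrier F" "\<phi> (c # xs' @ us) \<in> carrier F"
    "\<phi> (xs @ c # us) \<in> carrier F" "\<phi> (c' # xs' @ us) \<in> carrier F"
    "\<phi> (xs' @ c' # us) \<in> carrier F" "\<phi> (xs' @ c # us) \<in> carrier F"
    using E len by (auto intro!: phi_closed)
  \<comment> \<open>Omitting \<open>c\<close> leaves \<open>c'\<close> in the first factor and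
    carries \<open>c\<close> to the second; at the next index the roles are reversed.\<close>
  have fp: "f ?p = epsilon F [^] Suc ?p \<otimes> \<phi> (xs @ c' # us) \<otimes> \<phi> (c # xs' @ us)"
    by (simp add: f_def)
  have fq: "f (Suc ?p) = epsilon F [^] Suc (Suc ?p) \<otimes> \<phi> (xs @ c # us) \<otimes> \<phi> (c' # xs' @ us)"
    by (simp add: f_def nth_append)
  have "f (Suc ?p) = epsilon F \<otimes> f ?p"
    using two_term_null[OF _ _ null2] cl eps_pow_closed unfolding fp fq by blast
  \<comment> \<open>The factor \<open>epsilon F\<close> of the two-term relation makes up for the
    shift of the exponent by one, so equal powers appear on both sides and cancel.\<close>
  then have "epsilon F [^] Suc (Suc ?p) \<otimes> (\<phi> (xs @ c # us) \<otimes> \<phi> (c' # xs' @ us))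
    = epsilon F [^] Suc (Suc ?p) \<otimes> (\<phi> (xs @ c' # us) \<otimes> \<phi> (c # xs' @ us))"
    unfolding fp fq using cl eps_pow_closed[of ?p] eps_closed by (simp add: m_ac)
  then have A: "\<phi> (xs @ c # us) \<otimes> \<phi> (c' # xs' @ us) = \<phi> (xs @ c' # us) \<otimes> \<phi> (c # xs' @ us)"
    using nonzero_cancel[OF eps_pow_nonzero] cl by blast
  \<comment> \<open>Moving the front entry behind \<open>xs'\<close> costs a sign depending only on
    the length of \<open>xs'\<close>, hence the same sign for \<open>c\<close> and
    \<open>c'\<close>.\<close>
  have mv: "\<phi> (xs' @ a # us) = epsilon F [^] length xs' \<otimes> \<phi> (a # xs' @ us)" if "a \<in> E" for a
    using phi_move_front[of "[]" xs' a us] E len that by simp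
  show ?thesis
    using A cl eps_pow_closed[of "length xs'"] E mv[of c] mv[of c']
    by (simp add: m_lcomm)
qed

text \<open>One scalar must serve all prefixes. The set \<open>S\<close> limits the prefixes:
  contraction uses \<open>S = E\<close>, whereas deletion compares prefixes from the remaining
  ground set.\<close>

definition proportional :: "'e set \<Rightarrow> 'e list \<Rightarrow> 'e list \<Rightarrow> bool"
  where "proportional S us vs \<longleftrightarrow> (\<exists>c \<in> nonzero F. \<forall>xs. set xs \<subseteq> S \<and> length xs + length us = r \<longrightarrow>
    \<phi> (xs @ vs) = c \<otimes> \<phi> (xs @ us))"

lemma proportional_permute:
  assumes "mset us = mset vs" "set us \<subseteq> E"
  shows "proportional E us vs"
  using phi_permute[OF assms] eps_pow_nonzero unfolding proportional_def by blast

lemma proportional_trans: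
  assumes "proportional S us vs" "proportional S vs ws" "S \<subseteq> E" "set us \<subseteq> E"
    and "length us = length vs"
  shows "proportional S us ws"
proof -
  obtain c d where c: "c \<in> nonzero F" "\<And>xs. set xs \<subseteq> S \<and> length xs + length us = r \<Longrightarrow>
      \<phi> (xs @ vs) = c \<otimes> \<phi> (xs @ us)"
    and d: "d \<in> nonzero F" "\<And>xs. set xs \<subseteq> S \<and> length xs + length vs = r \<Longrightarrow>
      \<phi> (xs @ ws) = d \<otimes> \<phi> (xs @ vs)"
    using assms(1,2) unfolding proportional_def by blast
  have "\<phi> (xs @ ws) = (d \<otimes> c) \<otimes> \<phi> (xs @ us)" if "set xs \<subseteq> S \<and> length xs + length us = r" for xs
    using that c d phi_closed[of "xs @ us"] assms(3-5) by (auto simp: m_assoc nonzero_closed)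
  then show ?thesis unfolding proportional_def using mult_nonzero c d by blast
qed

text \<open>In the exchange identity fix \<open>x0\<close> with a nonzero value at
  \<open>c # us\<close> and divide by that value. The scalar is the quotient of the values at
  \<open>x0 @ c' # us\<close> and \<open>x0 @ c # us\<close>.\<close>

lemma proportional_exchange:
  assumes "distinct (c # us)" "distinct (c' # us)" "c \<noteq> c'"
    and max: "max_indep_in base_sets A (set (c # us))" "max_indep_in base_sets A (set (c' # us))"
  shows "proportional E (c # us) (c' # us)"
proof -
  obtain x0 where x0: "set x0 \<subseteq> E - A" "length x0 + length (c # us) = r" "\<phi> (x0 @ c # us) \<noteq> \<zero>\<^sub>F"
    using max_indep_complement_tuple[OF assms(1) max(1)] by blast
  obtain x1 where x1: "set x1 \<subseteq> E - A" "length x1 + length (c' # us) = r" "\<phi> (x1 @ c' # us) \<noteq> \<zero>\<^sub>F"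
    using max_indep_complement_tuple[OF assms(2) max(2)] by blast
  have E: "set (c # c' # us) \<subseteq> E" using max max_indep_inD(4) by force
  have dep: "\<not> indep base_sets (set (c # c' # us))"
  proof
    assume "indep base_sets (set (c # c' # us))"
    moreover have "set (c' # us) \<subseteq> set (c # c' # us)" by auto
    moreover have "set (c # c' # us) \<subseteq> A"
      using max_indep_inD(1)[OF max(1)] max_indep_inD(1)[OF max(2)] by simp
    ultimately have "set (c # c' # us) = set (c' # us)"
      using max(2) unfolding max_indep_in_def by metis
    then have "c \<in> set (c' # us)" by (metis list.set_intros(1))
    then show False using assms(1,3) by simp
  qed
  have id: "\<phi> (xs @ c # us) \<otimes> \<phi> (x0 @ c' # us) = \<phi> (xs @ c' # us) \<otimes> \<phi> (x0 @ c # us)"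
    if "set xs \<subseteq> E" "length xs + length (c # us) = r" for xs
    using that x0 E dep by (intro phi_exchange_identity) auto
  have cl: "\<phi> (xs @ c # us) \<in> carrier F" "\<phi> (xs @ c' # us) \<in> carrier F"
    if "set xs \<subseteq> E" "length xs + length (c # us) = r" for xs
    using that E by (auto intro!: phi_closed)
  have clx: "\<phi> (x0 @ c # us) \<in> carrier F" "\<phi> (x0 @ c' # us) \<in> carrier F"
    "\<phi> (x1 @ c # us) \<in> carrier F" "\<phi> (x1 @ c' # us) \<in> carrier F"
    using cl[of x0] cl[of x1] x0 x1 by auto
  \<comment> \<open>A second completion \<open>x1\<close>, chosen for \<open>c'\<close>, makes the
    right-hand side nonzero. Hence the numerator of the scalar is nonzero too.\<close>
  have "\<phi> (x1 @ c # us) \<otimes> \<phi> (x0 @ c' # us) = \<phi> (x1 @ c' # us) \<otimes> \<phi> (x0 @ c # us)"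
    using x1 by (intro id) auto
  then have "\<phi> (x1 @ c # us) \<otimes> \<phi> (x0 @ c' # us) \<noteq> \<zero>\<^sub>F"
    using x0(3) x1(3) clx by (simp add: mult_eq_zero_iff)
  then have nz: "\<phi> (x0 @ c' # us) \<in> nonzero F" "\<phi> (x0 @ c # us) \<in> nonzero F"
    using clx x0 by (auto simp: mult_eq_zero_iff intro: nonzeroI)
  obtain b where b: "b \<in> nonzero F" "b \<otimes> \<phi> (x0 @ c # us) = \<one>" using nonzero_inverse nz by blast
  have "\<phi> (xs @ c' # us) = (b \<otimes> \<phi> (x0 @ c' # us)) \<otimes> \<phi> (xs @ c # us)"
    if "set xs \<subseteq> E" "length xs + length (c # us) = r" for xs
  proof -
    have "(b \<otimes> \<phi> (x0 @ c' # us)) \<otimes> \<phi> (xs @ c # us) = b \<otimes> (\<phi> (xs @ c # us) \<otimes> \<phi> (x0 @ c' # us))"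
      using b(1) clx cl[OF that] by (simp add: nonzero_closed m_ac)
    also have "\<dots> = (b \<otimes> \<phi> (x0 @ c # us)) \<otimes> \<phi> (xs @ c' # us)"
      unfolding id[OF that] using b(1) clx cl[OF that] by (simp add: nonzero_closed m_ac)
    finally show ?thesis using b(2) cl[OF that] by simp
  qed
  then show ?thesis unfolding proportional_def using mult_nonzero[OF b(1) nz(1)] by blast
qed

text \<open>Induction on the number of entries of \<open>us\<close> outside \<open>vs\<close>. Each
  step permutes such an entry to the front and exchanges it for an entry of \<open>vs\<close>. At
  the end maximality makes the two sets equal, and only a permutation remains.\<close>

lemma max_indep_proportional:
  assumes "distinct us" "distinct vs"
    and "max_indep_in base_sets A (set us)" "max_indep_in base_sets A (set vs)"
  shows "proportional E us vs"
  using assms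
proof (induction "card (set us - set vs)" arbitrary: us rule: less_induct)
  case less
  note us = max_indep_inD[OF less.prems(3)]
  show ?case
  proof (cases "set us \<subseteq> set vs")
    case True
    then have "set us = set vs"
      using less.prems(3,4) unfolding max_indep_in_def by auto
    then show ?thesis
      using less.prems us(4) by (intro proportional_permute) (auto simp: set_eq_iff_mset_eq_distinct)
  next
    case False
    then obtain e where e: "e \<in> set us - set vs" by auto
    obtain f where f: "f \<in> set vs - set us" "max_indep_in base_sets A (insert f (set us - {e}))"
      using max_indep_exchange[OF less.prems(3,4) e] by blast
    obtain zs where zs: "set zs = set us - {e}" "distinct zs"
      using finite_distinct_list[of "set us - {e}"] by auto
    have ez: "distinct (e # zs)" "set (e # zs) = set us" using zs e by auto
    have fz: "distinct (f # zs)" "set (f # zs) = insert f (set us - {e})" using zs f by auto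
    have m: "mset us = mset (e # zs)"
      using ez less.prems(1) set_eq_iff_mset_eq_distinct by metis
    have 1: "proportional E us (e # zs)" using m us(4) by (rule proportional_permute)
    have 2: "proportional E (e # zs) (f # zs)"
      using ez fz f e less.prems by (intro proportional_exchange[of _ _ _ A]) auto
    have "set (f # zs) - set vs = (set us - set vs) - {e}" using fz(2) f by auto
    then have "card (set (f # zs) - set vs) < card (set us - set vs)"
      using e by (metis List.finite_set card_Diff1_less finite_Diff)
    then have 3: "proportional E (f # zs) vs"
      using less.hyps[of "f # zs"] fz f(2) less.prems by metis
    have "proportional E (e # zs) vs"
      using 2 3 us(4) ez by (intro proportional_trans[OF 2 3]) auto
    then show ?thesis
      using us(4) mset_eq_length[OF m] by (intro proportional_trans[OF 1]) simp_all
  qed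
qed

text \<open>Swapping the blocks gives the same power of \<open>epsilon F\<close> for
  \<open>us\<close> and \<open>vs\<close>, because their lengths agree; the scalar for trailing
  tuples thus also serves leading ones. Deletion needs this form, to vary the free
  arguments.\<close>

lemma max_indep_prefix_proportional:
  assumes "distinct us" "distinct vs"
    and "max_indep_in base_sets A (set us)" "max_indep_in base_sets A (set vs)"
  shows "\<exists>c \<in> nonzero F. \<forall>xs. set xs \<subseteq> E \<and> length xs + length us = r \<longrightarrow>
    \<phi> (vs @ xs) = c \<otimes> \<phi> (us @ xs)"
proof -
  obtain c where c: "c \<in> nonzero F" "\<And>xs. set xs \<subseteq> E \<and> length xs + length us = r \<Longrightarrow>
      \<phi> (xs @ vs) = c \<otimes> \<phi> (xs @ us)"
    using max_indep_proportional[OF assms] unfolding proportional_def by blast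
  have E: "set us \<subseteq> E" "set vs \<subseteq> E" using assms max_indep_inD(4) by auto
  have len: "length us = length vs"
    using assms by (metis distinct_card rank_of_max_indep)
  have "\<phi> (vs @ xs) = c \<otimes> \<phi> (us @ xs)" if xs: "set xs \<subseteq> E" "length xs + length us = r" for xs
    using phi_swap_blocks[of "[]" vs xs] phi_swap_blocks[of "[]" us xs] c(2)[of xs] xs E len
      phi_closed[of "xs @ us"] c(1) eps_pow_closed
    by (simp add: m_lcomm nonzero_closed)
  then show ?thesis using c(1) by blast
qed

lemma contract_basesE:
  assumes "distinct as" "set as \<in> contract_bases base_sets S"
  obtains ys where "distinct ys" "max_indep_in base_sets S (set ys)" "set as \<inter> S = {}" "set as \<subseteq> E"
    "length ys + length as = r" "\<phi> (ys @ as) \<noteq> \<zero>\<^sub>F"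
proof -
  obtain Z where Z: "set as \<inter> S = {}" "max_indep_in base_sets S Z" "set as \<union> Z \<in> base_sets"
    using assms(2) by (auto simp: contract_bases_def)
  obtain ys where ys: "set ys = Z" "distinct ys"
    using finite_distinct_list max_indep_inD(3)[OF Z(2)] by blast
  have "distinct (ys @ as)" "set (ys @ as) \<in> base_sets"
    using ys assms(1) Z max_indep_inD(1)[OF Z(2)] by (auto simp: Un_commute)
  from base_sets_imp_nonzero[OF this] show ?thesis using that[of ys] ys Z by auto
qed

text \<open>Fix a maximal independent \<open>ys\<close> in \<open>S\<close>. Replacing
  \<open>ys\<close> by another maximal independent prefix multiplies the values with
  \<open>as\<close> and with \<open>bs\<close> by the same scalar, so their ratio is the one found
  at \<open>ys\<close>. At repeated or dependent prefixes both values are zero.\<close>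

lemma contract_bases_proportional:
  assumes "distinct as" "distinct bs" "S \<subseteq> E"
    and "set as \<in> contract_bases base_sets S" "set bs \<in> contract_bases base_sets S"
  shows "proportional S as bs"
proof -
  obtain ys where ys: "distinct ys" "max_indep_in base_sets S (set ys)" "set as \<subseteq> E"
    "length ys + length as = r" "\<phi> (ys @ as) \<noteq> \<zero>\<^sub>F"
    using contract_basesE[OF assms(1,4)] by metis
  obtain zs where zs: "distinct zs" "max_indep_in base_sets S (set zs)" "set bs \<subseteq> E"
    "length zs + length bs = r" "\<phi> (zs @ bs) \<noteq> \<zero>\<^sub>F"
    using contract_basesE[OF assms(2,5)] by metis
  have lyz: "length zs = length ys" using ys zs by (metis distinct_card rank_of_max_indep)
  then have lab: "length bs = length as" using ys zs by linarith
  have ysE: "set ys \<subseteq> E" using max_indep_inD(4)[OF ys(2)] .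
  have cl: "\<phi> (ys @ as) \<in> carrier F" "\<phi> (ys @ bs) \<in> carrier F"
    using ys zs ysE lyz by (auto intro!: phi_closed)
  \<comment> \<open>Transfers the nonzero value with \<open>bs\<close> from its own completion
    \<open>zs\<close> to the common prefix \<open>ys\<close>, so that the ratio at \<open>ys\<close>
    is a nonzero scalar.\<close>
  obtain d1 where d1: "d1 \<in> nonzero F" "\<phi> (zs @ bs) = d1 \<otimes> \<phi> (ys @ bs)"
    using max_indep_prefix_proportional[OF ys(1) zs(1) ys(2) zs(2)] zs(3,4) lyz
    by (metis add.commute)
  have nz: "\<phi> (ys @ as) \<in> nonzero F" "\<phi> (ys @ bs) \<in> nonzero F"
    using cl ys(5) zs(5) d1 by (auto simp: absorb_right nonzero_closed intro!: nonzeroI)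
  obtain b where b: "b \<in> nonzero F" "b \<otimes> \<phi> (ys @ as) = \<one>" using nonzero_inverse nz by blast
  have "\<phi> (xs @ bs) = (b \<otimes> \<phi> (ys @ bs)) \<otimes> \<phi> (xs @ as)"
    if xs: "set xs \<subseteq> S" "length xs + length as = r" for xs
  proof (cases "distinct xs \<and> indep base_sets (set xs)")
    case True
    \<comment> \<open>An independent prefix without repetition has as many elements as
      \<open>ys\<close>, that is, the rank of \<open>S\<close>.\<close>
    then have "max_indep_in base_sets S (set xs)"
      unfolding max_indep_iff_card using xs ys rank_of_max_indep[OF ys(2)] by (simp add: distinct_card)
    then obtain d where d: "d \<in> nonzero F"
      "\<And>ws. set ws \<subseteq> E \<and> length ws + length ys = r \<Longrightarrow> \<phi> (xs @ ws) = d \<otimes> \<phi> (ys @ ws)"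
      using max_indep_prefix_proportional[OF ys(1) _ ys(2)] True by blast
    have "\<phi> (xs @ as) = d \<otimes> \<phi> (ys @ as)" "\<phi> (xs @ bs) = d \<otimes> \<phi> (ys @ bs)"
      using d(2)[of as] d(2)[of bs] ys zs lab by auto
    moreover have "(b \<otimes> \<phi> (ys @ bs)) \<otimes> (d \<otimes> \<phi> (ys @ as)) = (b \<otimes> \<phi> (ys @ as)) \<otimes> (d \<otimes> \<phi> (ys @ bs))"
      using b(1) d(1) cl by (simp add: nonzero_closed m_ac)
    ultimately show ?thesis using b(2) d(1) cl by (simp add: nonzero_closed)
  next
    case False
    have "\<phi> (xs @ ws) = \<zero>\<^sub>F" if "set ws \<subseteq> E" "length ws = length as" for ws
      using that False xs assms(3) phi_distinct[of "xs @ ws"] phi_nonzero_indep[of "xs @ ws" "set xs"]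
      by auto
    then have "\<phi> (xs @ as) = \<zero>\<^sub>F" "\<phi> (xs @ bs) = \<zero>\<^sub>F" using ys zs lab by auto
    then show ?thesis using b nz by (simp add: absorb_right mult_nonzero nonzero_closed)
  qed
  then show ?thesis unfolding proportional_def using mult_nonzero[OF b(1) nz(2)] by blast
qed

lemma contract_bases_exists:
  obtains as where "distinct as" "set as \<in> contract_bases base_sets S"
proof -
  obtain Z where Z: "max_indep_in base_sets S Z" using max_indep_exists[OF indep_empty] by blast
  obtain X where X: "X \<inter> S = {}" "X \<union> Z \<in> base_sets" using max_indep_complement_exists[OF Z] by blast
  then have "finite X" using basis_finite by blast
  then obtain as where "set as = X" "distinct as" using finite_distinct_list by blast
  then show ?thesis using that[of as] X Z by (auto simp: contract_bases_def)
qed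

end

section \<open>Freezing trailing arguments\<close>

context tract
begin

lemma gp_relations_append:
  assumes rel: "gp_relations F E w \<nu> r \<mu>"
    and cl: "\<nu> \<in> tuples E w \<rightarrow> carrier F" "\<mu> \<in> tuples E r \<rightarrow> carrier F"
    and E: "E' \<subseteq> E" "set bs \<subseteq> E" "set as \<subseteq> E"
    and len: "w' + length bs = w" "r' + length as = r"
    and van: "\<And>ys xs i. \<lbrakk>set ys \<subseteq> E'; length ys = Suc w'; set xs \<subseteq> E'; Suc (length xs) = r'; i < length bs\<rbrakk>
      \<Longrightarrow> \<nu> (ys @ take i bs @ drop (Suc i) bs) = \<zero>\<^sub>F \<or> \<mu> (bs ! i # xs @ as) = \<zero>\<^sub>F"
  shows "gp_relations F E' w' (\<lambda>xs \<in> tuples E' w'. \<nu> (xs @ bs)) r' (\<lambda>xs \<in> tuples E' r'. \<mu> (xs @ as))"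
  unfolding gp_relations_def
proof (intro allI impI, elim conjE)
  fix ys xs
  assume ys: "set ys \<subseteq> E'" "length ys = Suc w'" and xs: "set xs \<subseteq> E'" "Suc (length xs) = r'"
  define f where "f = (\<lambda>k. epsilon F [^] Suc k \<otimes> \<nu> (take k (ys @ bs) @ drop (Suc k) (ys @ bs)) \<otimes>
    \<mu> ((ys @ bs) ! k # xs @ as))"
  have "gp_sum F \<nu> \<mu> (ys @ bs) (xs @ as) \<in> nullset F"
    using ys xs E len by (intro rel[unfolded gp_relations_def, rule_format]) auto
  then have null: "formal_sum F (map f [0..<length (ys @ bs)]) \<in> nullset F"
    by (simp only: gp_sum_def f_def)
  have "f k = \<zero>\<^sub>F" if k: "k \<in> {length ys..<length (ys @ bs)}" for k
  proof -
    obtain i where i: "k = length ys + i" "i < length bs"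
      using k le_Suc_ex[of "length ys" k] by auto
    have fk: "f k = epsilon F [^] Suc k \<otimes> \<nu> (ys @ take i bs @ drop (Suc i) bs) \<otimes> \<mu> (bs ! i # xs @ as)"
      by (simp add: f_def i)
    have "\<nu> (ys @ take i bs @ drop (Suc i) bs) \<in> carrier F"
      using cl(1) ys E len i set_take_subset[of i bs] set_drop_subset[of "Suc i" bs]
      by (intro funcset_mem[OF cl(1)]) (auto simp: tuples_def)
    moreover have "\<mu> (bs ! i # xs @ as) \<in> carrier F"
      using xs E len i nth_mem[OF i(2)] by (intro funcset_mem[OF cl(2)]) (auto simp: tuples_def)
    ultimately show ?thesis
      unfolding fk using van[OF ys xs i(2)] eps_pow_closed by (intro triple_product_zero)
  qed
  then have zs: "t = \<zero>\<^sub>F" if "t \<in> set (map f [length ys..<length (ys @ bs)])" for t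
    using that by (auto simp del: length_append)
  have "[0..<length (ys @ bs)] = [0..<length ys] @ [length ys..<length (ys @ bs)]"
    using upt_add_eq_append[of 0 "length ys" "length bs"] by simp
  then have "formal_sum F (map f [0..<length ys]) \<in> nullset F"
    using null zs by (simp only: map_append formal_sum_append_zeros)
  \<comment> \<open>At these indices the omission happens inside \<open>ys\<close>, so
    \<open>bs\<close> stays whole and all arguments lie where the restricted functions agree with
    the original ones.\<close>
  moreover have "map f [0..<length ys] = map (\<lambda>k. epsilon F [^] Suc k \<otimes>
      (\<lambda>xs \<in> tuples E' w'. \<nu> (xs @ bs)) (take k ys @ drop (Suc k) ys) \<otimes>
      (\<lambda>xs \<in> tuples E' r'. \<mu> (xs @ as)) (ys ! k # xs)) [0..<length ys]"
  proof (intro map_cong refl)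
    fix k assume "k \<in> set [0..<length ys]"
    then have k: "k < length ys" by simp
    have "take k ys @ drop (Suc k) ys \<in> tuples E' w'"
      using k ys set_take_subset[of k ys] set_drop_subset[of "Suc k" ys] by (auto simp: tuples_def)
    moreover have "ys ! k # xs \<in> tuples E' r'" using k ys xs nth_mem[OF k] by (auto simp: tuples_def)
    ultimately show "f k = epsilon F [^] Suc k \<otimes>
      (\<lambda>xs \<in> tuples E' w'. \<nu> (xs @ bs)) (take k ys @ drop (Suc k) ys) \<otimes>
      (\<lambda>xs \<in> tuples E' r'. \<mu> (xs @ as)) (ys ! k # xs)"
      using k by (simp add: f_def nth_append)
  qed
  ultimately show "gp_sum F (\<lambda>xs \<in> tuples E' w'. \<nu> (xs @ bs)) (\<lambda>xs \<in> tuples E' r'. \<mu> (xs @ as)) ys xs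
    \<in> nullset F"
    by (simp only: gp_sum_def)
qed

lemma alternating_append:
  assumes "alternating F E r \<phi>" "E' \<subseteq> E" "set as \<subseteq> E" "r' + length as = r"
  shows "alternating F E' r' (\<lambda>xs \<in> tuples E' r'. \<phi> (xs @ as))"
  unfolding alternating_def
proof (intro ballI allI impI)
  fix xs i j assume xs: "xs \<in> tuples E' r'" and ij: "i < j \<and> j < r'"
  have l: "length xs = r'" "set xs \<subseteq> E'" using xs by (auto simp: tuples_def)
  have "xs @ as \<in> tuples E r" using l assms by (auto simp: tuples_def)
  moreover have "i < j \<and> j < r" using ij assms(4) by simp
  ultimately have "\<phi> ((xs @ as)[i := (xs @ as) ! j, j := (xs @ as) ! i]) = epsilon F \<otimes> \<phi> (xs @ as) \<and>
      ((xs @ as) ! i = (xs @ as) ! j \<longrightarrow> \<phi> (xs @ as) = \<zero>\<^sub>F)"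
    using assms(1) unfolding alternating_def by blast
  moreover have "xs ! i \<in> E'" "xs ! j \<in> E'" using l ij nth_mem by fastforce+
  then have "xs[i := xs ! j, j := xs ! i] \<in> tuples E' r'"
    using l set_update_subsetI[of "xs[i := xs ! j]" E' "xs ! i" j] set_update_subsetI[of xs E' "xs ! j" i]
    by (simp add: tuples_def)
  ultimately show "(\<lambda>xs \<in> tuples E' r'. \<phi> (xs @ as)) (xs[i := xs ! j, j := xs ! i]) =
      epsilon F \<otimes> (\<lambda>xs \<in> tuples E' r'. \<phi> (xs @ as)) xs \<and>
      (xs ! i = xs ! j \<longrightarrow> (\<lambda>xs \<in> tuples E' r'. \<phi> (xs @ as)) xs = \<zero>\<^sub>F)"
    using xs l ij by (simp add: nth_append list_update_append1)
qed

text \<open>The choice of representative and the choice of frozen tuple each contribute a nonzero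
  scalar, and these multiply to one. Conversely the single tuple \<open>as\<close> already yields
  every member of the class.\<close>

lemma gp_class_append:
  assumes E: "E' \<subseteq> E" "as \<in> Q" "\<phi> \<in> tuples E r \<rightarrow> carrier F"
    and Q: "\<And>bs. bs \<in> Q \<Longrightarrow> set bs \<subseteq> E \<and> r' + length bs = r"
    and scal: "\<And>bs. bs \<in> Q \<Longrightarrow> \<exists>c \<in> nonzero F. \<forall>xs \<in> tuples E' r'. \<phi> (xs @ bs) = c \<otimes> \<phi> (xs @ as)"
  shows "{\<lambda>xs \<in> tuples E' r'. \<psi> (xs @ bs) | \<psi> bs. \<psi> \<in> gp_class F E r \<phi> \<and> bs \<in> Q} =
    gp_class F E' r' (\<lambda>xs \<in> tuples E' r'. \<phi> (xs @ as))" (is "?L = ?R")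
proof -
  have tup: "xs @ bs \<in> tuples E r" if "xs \<in> tuples E' r'" "bs \<in> Q" for xs bs
    using that E Q[OF that(2)] by (auto simp: tuples_def)
  show ?thesis
  proof (intro equalityI subsetI)
    fix g assume "g \<in> ?L"
    then obtain c bs where c: "c \<in> nonzero F" and bs: "bs \<in> Q"
      and g: "g = (\<lambda>xs \<in> tuples E' r'. (\<lambda>xs \<in> tuples E r. c \<otimes> \<phi> xs) (xs @ bs))"
      by (auto simp: gp_class_def)
    obtain d where d: "d \<in> nonzero F" "\<And>xs. xs \<in> tuples E' r' \<Longrightarrow> \<phi> (xs @ bs) = d \<otimes> \<phi> (xs @ as)"
      using scal[OF bs] by blast
    have "g = (\<lambda>xs \<in> tuples E' r'. (c \<otimes> d) \<otimes> (\<lambda>xs \<in> tuples E' r'. \<phi> (xs @ as)) xs)"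
      unfolding g
    proof (rule restrict_ext)
      fix xs assume xs: "xs \<in> tuples E' r'"
      have "\<phi> (xs @ as) \<in> carrier F" using E tup[OF xs E(2)] by blast
      then show "(\<lambda>xs \<in> tuples E r. c \<otimes> \<phi> xs) (xs @ bs) =
          (c \<otimes> d) \<otimes> (\<lambda>xs \<in> tuples E' r'. \<phi> (xs @ as)) xs"
        using xs tup[OF xs bs] d c by (simp add: m_assoc nonzero_closed)
    qed
    then show "g \<in> ?R" using mult_nonzero[OF c d(1)] unfolding gp_class_def by blast
  next
    fix g assume "g \<in> ?R"
    then obtain c where c: "c \<in> nonzero F"
      and g: "g = (\<lambda>xs \<in> tuples E' r'. c \<otimes> (\<lambda>xs \<in> tuples E' r'. \<phi> (xs @ as)) xs)"
      by (auto simp: gp_class_def)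
    have "g = (\<lambda>xs \<in> tuples E' r'. (\<lambda>xs \<in> tuples E r. c \<otimes> \<phi> xs) (xs @ as))"
      unfolding g using tup E(2) by (intro restrict_ext) simp
    then show "g \<in> ?L" using c E(2) unfolding gp_class_def by blast
  qed
qed

text \<open>Common core of deletion and contraction: \<open>Q\<close> holds the admissible frozen
  tuples, \<open>ex\<close> keeps the function nonzero, \<open>scal\<close> absorbs the choice from
  \<open>Q\<close> into a scalar, and \<open>van\<close> removes the surplus terms of the
  relation.\<close>

lemma minor_F_matroid:
  assumes gp: "GP_function F E r \<phi>" and E: "E' \<subseteq> E" "as \<in> Q"
    and Q: "\<And>bs. bs \<in> Q \<Longrightarrow> set bs \<subseteq> E \<and> r' + length bs = r"
    and ex: "\<exists>xs \<in> tuples E' r'. \<phi> (xs @ as) \<noteq> \<zero>\<^sub>F"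
    and scal: "\<And>bs. bs \<in> Q \<Longrightarrow> \<exists>c \<in> nonzero F. \<forall>xs \<in> tuples E' r'. \<phi> (xs @ bs) = c \<otimes> \<phi> (xs @ as)"
    and van: "\<And>ys xs i. \<lbrakk>set ys \<subseteq> E'; length ys = Suc r'; set xs \<subseteq> E'; Suc (length xs) = r'; i < length as\<rbrakk>
      \<Longrightarrow> \<phi> (ys @ take i as @ drop (Suc i) as) = \<zero>\<^sub>F \<or> \<phi> (as ! i # xs @ as) = \<zero>\<^sub>F"
  shows "F_matroid F \<lparr>ground = E', mrank = r', gpfuns =
    {\<lambda>xs \<in> tuples E' r'. \<psi> (xs @ bs) | \<psi> bs. \<psi> \<in> gp_class F E r \<phi> \<and> bs \<in> Q}\<rparr>"
proof -
  have \<phi>: "\<phi> \<in> tuples E r \<rightarrow> carrier F" "alternating F E r \<phi>" "gp_relations F E r \<phi> r \<phi>"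
    using gp by (auto simp: GP_function_def)
  have as: "set as \<subseteq> E" "r' + length as = r" using Q[OF E(2)] by auto
  have "GP_function F E' r' (\<lambda>xs \<in> tuples E' r'. \<phi> (xs @ as))"
    unfolding GP_function_def
  proof (intro conjI)
    have "xs @ as \<in> tuples E r" if "xs \<in> tuples E' r'" for xs
      using that as E by (auto simp: tuples_def)
    then show "(\<lambda>xs \<in> tuples E' r'. \<phi> (xs @ as)) \<in> tuples E' r' \<rightarrow> carrier F"
      using \<phi>(1) by auto
    show "\<exists>xs \<in> tuples E' r'. (\<lambda>xs \<in> tuples E' r'. \<phi> (xs @ as)) xs \<noteq> \<zero>\<^sub>F" using ex by auto
    show "alternating F E' r' (\<lambda>xs \<in> tuples E' r'. \<phi> (xs @ as))"
      using alternating_append[OF \<phi>(2) E(1) as] .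
    show "gp_relations F E' r' (\<lambda>xs \<in> tuples E' r'. \<phi> (xs @ as)) r' (\<lambda>xs \<in> tuples E' r'. \<phi> (xs @ as))"
      using gp_relations_append[OF \<phi>(3) \<phi>(1) \<phi>(1) E(1) as(1) as(1) as(2) as(2) van] .
  qed
  then show ?thesis
    unfolding F_matroid_def using gp_class_append[OF E(1,2) \<phi>(1) Q scal] by auto
qed

section \<open>Deletions and contractions of F-matroids\<close>

lemma F_matroidE:
  assumes "F_matroid F M" "finite (ground M)"
  obtains \<phi> where "gp_fun F (ground M) (mrank M) \<phi>"
    "gpfuns M = gp_class F (ground M) (mrank M) \<phi>"
    "bases F M = gp_fun.base_sets F (ground M) (mrank M) \<phi>"
proof -
  obtain \<phi> where \<phi>: "GP_function F (ground M) (mrank M) \<phi>"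
    "gpfuns M = gp_class F (ground M) (mrank M) \<phi>"
    using assms by (auto simp: F_matroid_def)
  interpret gp_fun F "ground M" "mrank M" \<phi>
    using \<phi> assms by unfold_locales auto
  have "c \<otimes> \<phi> xs = \<zero>\<^sub>F \<longleftrightarrow> \<phi> xs = \<zero>\<^sub>F" if "c \<in> nonzero F" "xs \<in> tuples (ground M) (mrank M)" for c xs
    using that phi_closed[of xs] mult_eq_zero_iff[of c "\<phi> xs"] by (auto simp: tuples_def nonzero_def)
  then have "bases F M = base_sets"
    unfolding bases_def base_sets_def \<phi>(2) gp_class_def using one_nonzero by force
  then show ?thesis using that \<phi> gp_fun_axioms by blast
qed

text \<open>Quotients quantify over all representatives, so the facts on values and support are
  needed for every member of the class.\<close>

lemma F_matroid_gpfun: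
  assumes "F_matroid F M" "finite (ground M)" "\<psi> \<in> gpfuns M"
  shows "\<psi> \<in> tuples (ground M) (mrank M) \<rightarrow> carrier F"
    and "\<lbrakk>xs \<in> tuples (ground M) (mrank M); \<psi> xs \<noteq> \<zero>\<^sub>F\<rbrakk> \<Longrightarrow> distinct xs \<and> set xs \<in> bases F M"
proof -
  obtain \<phi> where \<phi>: "gp_fun F (ground M) (mrank M) \<phi>"
    "gpfuns M = gp_class F (ground M) (mrank M) \<phi>"
    using F_matroidE[OF assms(1,2)] by blast
  interpret gp_fun F "ground M" "mrank M" \<phi> by fact
  obtain c where c: "c \<in> nonzero F" "\<psi> = (\<lambda>xs \<in> tuples (ground M) (mrank M). c \<otimes> \<phi> xs)"
    using assms(3) \<phi>(2) by (auto simp: gp_class_def)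
  show "\<psi> \<in> tuples (ground M) (mrank M) \<rightarrow> carrier F"
    using c phi_closed by (auto simp: tuples_def nonzero_closed)
  assume xs: "xs \<in> tuples (ground M) (mrank M)" "\<psi> xs \<noteq> \<zero>\<^sub>F"
  then have "\<phi> xs \<noteq> \<zero>\<^sub>F" using c by (auto simp: absorb_right nonzero_closed)
  then have "distinct xs" using phi_distinct xs by (auto simp: tuples_def)
  then show "distinct xs \<and> set xs \<in> bases F M" using xs assms(3) by (auto simp: bases_def)
qed

lemma F_matroid_basis_system:
  assumes "F_matroid F M" "finite (ground M)"
  shows "basis_system (ground M) (mrank M) (bases F M)"
proof -
  obtain \<phi> where \<phi>: "gp_fun F (ground M) (mrank M) \<phi>"
    "bases F M = gp_fun.base_sets F (ground M) (mrank M) \<phi>"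
    using F_matroidE[OF assms] by blast
  interpret gp_fun F "ground M" "mrank M" \<phi> by fact
  show ?thesis using basis_system_axioms \<phi>(2) by simp
qed

lemma deletion_F_matroid:
  assumes "F_matroid F M" "finite (ground M)"
  shows "F_matroid F (deletion F M I)"
proof -
  obtain \<phi> where \<phi>: "gp_fun F (ground M) (mrank M) \<phi>"
    "gpfuns M = gp_class F (ground M) (mrank M) \<phi>"
    "bases F M = gp_fun.base_sets F (ground M) (mrank M) \<phi>"
    using F_matroidE[OF assms] by blast
  interpret gp_fun F "ground M" "mrank M" \<phi> by fact
  define S where "S = ground M - I"
  define Q where "Q = {as. distinct as \<and> set as \<in> contract_bases base_sets S}"
  define k where "k = rank_of base_sets S"
  have S: "S \<subseteq> ground M" by (auto simp: S_def)
  have Q: "set bs \<subseteq> ground M \<and> k + length bs = mrank M" if "bs \<in> Q" for bs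
    using that contract_bases_card[of "set bs" S] by (simp add: Q_def k_def distinct_card)
  obtain as where as: "as \<in> Q" using contract_bases_exists[of S] unfolding Q_def by blast
  obtain ys where ys: "max_indep_in base_sets S (set ys)"
    "length ys + length as = mrank M" "\<phi> (ys @ as) \<noteq> \<zero>\<^sub>F"
    using contract_basesE[of as S] as unfolding Q_def by blast
  have "ys \<in> tuples S k" using ys(2) Q[OF as] max_indep_inD(1)[OF ys(1)] by (simp add: tuples_def)
  then have ex: "\<exists>xs \<in> tuples S k. \<phi> (xs @ as) \<noteq> \<zero>\<^sub>F" using ys(3) by blast
  have scal: "\<exists>c \<in> nonzero F. \<forall>xs \<in> tuples S k. \<phi> (xs @ bs) = c \<otimes> \<phi> (xs @ as)" if "bs \<in> Q" for bs
    using contract_bases_proportional[of as bs S] S as that Q[OF as]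
    unfolding proportional_def tuples_def Q_def by blast
  \<comment> \<open>Here the first factor vanishes: \<open>ys\<close> has one entry more than the
    rank of \<open>S\<close>, so it is repeated or dependent.\<close>
  have van: "\<phi> (ys @ take i as @ drop (Suc i) as) = \<zero>\<^sub>F \<or> \<phi> (as ! i # xs @ as) = \<zero>\<^sub>F"
    if ys: "set ys \<subseteq> S" "length ys = Suc k" and i: "i < length as" for ys xs i
  proof (rule disjI1, rule ccontr)
    let ?L = "ys @ take i as @ drop (Suc i) as"
    assume nz: "\<phi> ?L \<noteq> \<zero>\<^sub>F"
    have L: "set ?L \<subseteq> ground M" "length ?L = mrank M"
      using ys i S Q[OF as] set_take_subset[of i as] set_drop_subset[of "Suc i" as] by auto
    have "distinct ys" using phi_distinct[OF L nz] by simp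
    moreover have "indep base_sets (set ys)" using phi_nonzero_indep[OF L nz] by simp
    ultimately show False
      using indep_card_le_rank_of[of "set ys" S] ys by (simp add: distinct_card k_def)
  qed
  have "F_matroid F \<lparr>ground = S, mrank = k, gpfuns =
      {\<lambda>xs \<in> tuples S k. \<psi> (xs @ bs) | \<psi> bs. \<psi> \<in> gp_class F (ground M) (mrank M) \<phi> \<and> bs \<in> Q}\<rparr>"
    using minor_F_matroid[OF gp S as Q ex scal] van by blast
  then show ?thesis
    by (simp add: deletion_def Let_def \<phi>(2,3) Q_def S_def k_def)
qed

lemma contraction_F_matroid:
  assumes "F_matroid F M" "finite (ground M)"
  shows "F_matroid F (contraction F M A)"
proof -
  obtain \<phi> where \<phi>: "gp_fun F (ground M) (mrank M) \<phi>"
    "gpfuns M = gp_class F (ground M) (mrank M) \<phi>"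
    "bases F M = gp_fun.base_sets F (ground M) (mrank M) \<phi>"
    using F_matroidE[OF assms] by blast
  interpret gp_fun F "ground M" "mrank M" \<phi> by fact
  define S where "S = ground M - A"
  define Q where "Q = {as. distinct as \<and> max_indep_in base_sets A (set as)}"
  define k where "k = mrank M - rank_of base_sets A"
  have S: "S \<subseteq> ground M" by (auto simp: S_def)
  have Q: "set bs \<subseteq> ground M \<and> k + length bs = mrank M" if "bs \<in> Q" for bs
    using that max_indep_inD(4)[of A "set bs"] corank_plus_card_max_indep[of A "set bs"]
    by (simp add: Q_def k_def distinct_card)
  obtain Z where Z: "max_indep_in base_sets A Z" using max_indep_exists[OF indep_empty] by blast
  obtain as where "set as = Z" "distinct as"
    using finite_distinct_list[OF max_indep_inD(3)[OF Z]] by blast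
  then have as: "as \<in> Q" using Z by (simp add: Q_def)
  obtain zs where "set zs \<subseteq> S" "length zs + length as = mrank M" "\<phi> (zs @ as) \<noteq> \<zero>\<^sub>F"
    using max_indep_complement_tuple[of as A] as by (auto simp: Q_def S_def)
  then have ex: "\<exists>xs \<in> tuples S k. \<phi> (xs @ as) \<noteq> \<zero>\<^sub>F"
    using Q[OF as] by (intro bexI[of _ zs]) (auto simp: tuples_def)
  have scal: "\<exists>c \<in> nonzero F. \<forall>xs \<in> tuples S k. \<phi> (xs @ bs) = c \<otimes> \<phi> (xs @ as)" if bs: "bs \<in> Q" for bs
  proof -
    obtain c where "c \<in> nonzero F" "\<And>xs. set xs \<subseteq> ground M \<and> length xs + length as = mrank M \<Longrightarrow>
        \<phi> (xs @ bs) = c \<otimes> \<phi> (xs @ as)"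
      using max_indep_proportional[of as bs A] as bs unfolding proportional_def Q_def by blast
    then show ?thesis using S Q[OF as] by (intro bexI[of _ c]) (auto simp: tuples_def)
  qed
  \<comment> \<open>Here the second factor vanishes, since the omitted entry \<open>as ! i\<close>
    meets its own copy in \<open>as\<close>.\<close>
  have van: "\<phi> (ys @ take i as @ drop (Suc i) as) = \<zero>\<^sub>F \<or> \<phi> (as ! i # xs @ as) = \<zero>\<^sub>F"
    if xs: "set xs \<subseteq> S" "Suc (length xs) = k" and i: "i < length as" for ys xs i
  proof (rule disjI2, rule ccontr)
    assume nz: "\<phi> (as ! i # xs @ as) \<noteq> \<zero>\<^sub>F"
    have "set (as ! i # xs @ as) \<subseteq> ground M" "length (as ! i # xs @ as) = mrank M"
      using xs i S Q[OF as] nth_mem[OF i] by auto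
    from phi_distinct[OF this nz] show False using i by simp
  qed
  have "F_matroid F \<lparr>ground = S, mrank = k, gpfuns =
      {\<lambda>xs \<in> tuples S k. \<psi> (xs @ bs) | \<psi> bs. \<psi> \<in> gp_class F (ground M) (mrank M) \<phi> \<and> bs \<in> Q}\<rparr>"
    using minor_F_matroid[OF gp S as Q ex scal] van by blast
  then show ?thesis
    by (simp add: contraction_def Let_def \<phi>(2,3) Q_def S_def k_def)
qed

section \<open>Quotients under deletion and contraction\<close>

lemma quotient_deletion:
  assumes N: "F_matroid F N" and M: "F_matroid F M" and fin: "finite (ground M)"
    and q: "quotient F N M"
  shows "quotient F (deletion F N I) (deletion F M I)"
proof -
  have g: "ground N = ground M" using q by (simp add: quotient_def)
  define S where "S = ground M - I"
  have S: "S \<subseteq> ground M" by (auto simp: S_def)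
  interpret N: basis_system "ground M" "mrank N" "bases F N"
    using F_matroid_basis_system[OF N] fin g by simp
  interpret M: basis_system "ground M" "mrank M" "bases F M"
    using F_matroid_basis_system[OF M] fin by simp
  have "gp_relations F S (rank_of (bases F N) S) (\<lambda>xs \<in> tuples S (rank_of (bases F N) S). \<nu> (xs @ bs))
      (rank_of (bases F M) S) (\<lambda>xs \<in> tuples S (rank_of (bases F M) S). \<mu> (xs @ as))"
    if \<nu>: "\<nu> \<in> gpfuns N" and \<mu>: "\<mu> \<in> gpfuns M"
      and bs: "distinct bs" "set bs \<in> contract_bases (bases F N) S"
      and as: "distinct as" "set as \<in> contract_bases (bases F M) S" for \<nu> \<mu> as bs
  proof (rule gp_relations_append[where E = "ground M" and w = "mrank N" and r = "mrank M"])
    show "gp_relations F (ground M) (mrank N) \<nu> (mrank M) \<mu>" using q \<nu> \<mu> by (simp add: quotient_def)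
    show "\<nu> \<in> tuples (ground M) (mrank N) \<rightarrow> carrier F"
      using F_matroid_gpfun(1)[OF N _ \<nu>] fin g by simp
    show "\<mu> \<in> tuples (ground M) (mrank M) \<rightarrow> carrier F"
      using F_matroid_gpfun(1)[OF M fin \<mu>] .
    show "S \<subseteq> ground M" by (rule S)
    show bsE: "set bs \<subseteq> ground M" and lb: "rank_of (bases F N) S + length bs = mrank N"
      using N.contract_bases_card[OF bs(2)] bs(1) by (simp_all add: distinct_card)
    show "set as \<subseteq> ground M" "rank_of (bases F M) S + length as = mrank M"
      using M.contract_bases_card[OF as(2)] as(1) by (simp_all add: distinct_card)
    fix ys xs i
    assume ys: "set ys \<subseteq> S" "length ys = Suc (rank_of (bases F N) S)" and i: "i < length bs"
    let ?L = "ys @ take i bs @ drop (Suc i) bs"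
    show "\<nu> ?L = \<zero>\<^sub>F \<or> \<mu> (bs ! i # xs @ as) = \<zero>\<^sub>F"
    \<comment> \<open>Only the rank of \<open>S\<close> in \<open>N\<close> enters: a nonzero value
      would make the too long \<open>ys\<close> independent there.\<close>
    proof (rule disjI1, rule ccontr)
      assume nz: "\<nu> ?L \<noteq> \<zero>\<^sub>F"
      have "?L \<in> tuples (ground N) (mrank N)"
        using ys i S bsE lb g set_take_subset[of i bs] set_drop_subset[of "Suc i" bs]
        by (auto simp: tuples_def)
      then have L: "distinct ?L" "set ?L \<in> bases F N"
        using F_matroid_gpfun(2)[OF N _ \<nu> _ nz] fin g by auto
      have "indep (bases F N) (set ys)"
        using L(2) unfolding indep_def by (metis Un_upper1 set_append)
      then show False
        using N.indep_card_le_rank_of[of "set ys" S] ys L(1) by (simp add: distinct_card)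
    qed
  qed
  then show ?thesis
    unfolding quotient_def by (auto simp: deletion_def Let_def g S_def)
qed

lemma quotient_contraction:
  assumes N: "F_matroid F N" and M: "F_matroid F M" and fin: "finite (ground M)"
    and q: "quotient F N M"
  shows "quotient F (contraction F N A) (contraction F M A)"
proof -
  have g: "ground N = ground M" using q by (simp add: quotient_def)
  define S where "S = ground M - A"
  have S: "S \<subseteq> ground M" by (auto simp: S_def)
  interpret N: basis_system "ground M" "mrank N" "bases F N"
    using F_matroid_basis_system[OF N] fin g by simp
  interpret M: basis_system "ground M" "mrank M" "bases F M"
    using F_matroid_basis_system[OF M] fin by simp
  define w where "w = mrank N - rank_of (bases F N) A"
  define r where "r = mrank M - rank_of (bases F M) A"
  have "gp_relations F S w (\<lambda>xs \<in> tuples S w. \<nu> (xs @ bs)) r (\<lambda>xs \<in> tuples S r. \<mu> (xs @ as))"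
    if \<nu>: "\<nu> \<in> gpfuns N" and \<mu>: "\<mu> \<in> gpfuns M"
      and bs: "distinct bs" "max_indep_in (bases F N) A (set bs)"
      and as: "distinct as" "max_indep_in (bases F M) A (set as)" for \<nu> \<mu> as bs
  proof (rule gp_relations_append[where E = "ground M" and w = "mrank N" and r = "mrank M"])
    show "gp_relations F (ground M) (mrank N) \<nu> (mrank M) \<mu>" using q \<nu> \<mu> by (simp add: quotient_def)
    show "\<nu> \<in> tuples (ground M) (mrank N) \<rightarrow> carrier F"
      using F_matroid_gpfun(1)[OF N _ \<nu>] fin g by simp
    show "\<mu> \<in> tuples (ground M) (mrank M) \<rightarrow> carrier F"
      using F_matroid_gpfun(1)[OF M fin \<mu>] .
    show "S \<subseteq> ground M" by (rule S)
    show bsE: "set bs \<subseteq> ground M" using N.max_indep_inD(4)[OF bs(2)] .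
    show asE: "set as \<subseteq> ground M" using M.max_indep_inD(4)[OF as(2)] .
    show "w + length bs = mrank N"
      using N.corank_plus_card_max_indep[OF bs(2)] bs(1) by (simp add: distinct_card w_def)
    show la: "r + length as = mrank M"
      using M.corank_plus_card_max_indep[OF as(2)] as(1) by (simp add: distinct_card r_def)
    fix ys xs i
    assume xs: "set xs \<subseteq> S" "Suc (length xs) = r" and i: "i < length bs"
    let ?R = "bs ! i # xs @ as"
    have bi: "bs ! i \<in> A" "bs ! i \<in> ground M"
      using nth_mem[OF i] bsE N.max_indep_inD(1)[OF bs(2)] by auto
    show "\<nu> (ys @ take i bs @ drop (Suc i) bs) = \<zero>\<^sub>F \<or> \<mu> ?R = \<zero>\<^sub>F"
    proof (rule disjI2, rule ccontr)
      assume nz: "\<mu> ?R \<noteq> \<zero>\<^sub>F"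
      have "?R \<in> tuples (ground M) (mrank M)" using bi xs S asE la by (auto simp: tuples_def)
      then have R: "distinct ?R" "set ?R \<in> bases F M"
        using F_matroid_gpfun(2)[OF M fin \<mu> _ nz] by auto
      \<comment> \<open>Distinctness of \<open>?R\<close> puts \<open>bs ! i\<close> in
        \<open>A\<close> but outside \<open>as\<close>, so a basis containing both contradicts
        maximality of \<open>as\<close> in \<open>A\<close>. If \<open>bs ! i\<close> occurs in
        \<open>as\<close>, distinctness already fails.\<close>
      then show False
        using M.max_indep_insert_not_basis[OF as(2), of "bs ! i" "set ?R"] bi(1) by auto
    qed
  qed
  then show ?thesis
    unfolding quotient_def by (auto simp: contraction_def Let_def g S_def w_def r_def)
qed

section \<open>Flags of minors\<close>

lemma flag_map:
  assumes "flag_F_matroid F E Ms"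
    and "\<And>M. \<lbrakk>F_matroid F M; ground M = E\<rbrakk> \<Longrightarrow> F_matroid F (h M) \<and> ground (h M) = E'"
    and "\<And>N M. \<lbrakk>F_matroid F N; F_matroid F M; ground M = E; quotient F N M\<rbrakk> \<Longrightarrow> quotient F (h N) (h M)"
  shows "flag_F_matroid F E' (map h Ms)"
proof -
  have "quotient F (h (Ms ! j)) (h (Ms ! i))" if "i < j" "j < length Ms" for i j
    using assms(1,3) that nth_mem[of i Ms] nth_mem[of j Ms] unfolding flag_F_matroid_def by auto
  then show ?thesis using assms(1,2) unfolding flag_F_matroid_def by auto
qed

lemma flag_deletion:
  assumes "flag_F_matroid F E Ms" "finite E"
  shows "flag_F_matroid F (E - A) (map (\<lambda>M. deletion F M A) Ms)"
  using assms(1)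
proof (rule flag_map)
  show "F_matroid F (deletion F M A) \<and> ground (deletion F M A) = E - A"
    if "F_matroid F M" "ground M = E" for M
    using that assms(2) deletion_F_matroid[of M] by (auto simp: deletion_def Let_def)
qed (use assms(2) quotient_deletion in auto)

lemma flag_contraction:
  assumes "flag_F_matroid F E Ms" "finite E"
  shows "flag_F_matroid F (E - A) (map (\<lambda>M. contraction F M A) Ms)"
  using assms(1)
proof (rule flag_map)
  show "F_matroid F (contraction F M A) \<and> ground (contraction F M A) = E - A"
    if "F_matroid F M" "ground M = E" for M
    using that assms(2) contraction_F_matroid[of M] by (auto simp: contraction_def Let_def)
qed (use assms(2) quotient_contraction in auto)

end

theorem theorem2p14:
  fixes F :: "('a, 'b) tract_scheme"
    and \<tau> :: "'a \<Rightarrow> 'a"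
    and E I J :: "'e::linorder set"
    and Ms :: "('e, 'a) fmatroid list"
  assumes "tract F"
    and "tract_involution F \<tau>"
    and "finite E"
    and "flag_F_matroid F E Ms"
    and "I \<subseteq> E" and "J \<subseteq> E" and "I \<inter> J = {}"
  shows "flag_F_matroid F (E - (I \<union> J)) (map (\<lambda>M. contraction F (deletion F M I) J) Ms)"
proof -
  interpret tract F by fact
  have "flag_F_matroid F (E - I) (map (\<lambda>M. deletion F M I) Ms)"
    using flag_deletion assms(3,4) by blast
  then have "flag_F_matroid F (E - I - J)
      (map (\<lambda>M. contraction F M J) (map (\<lambda>M. deletion F M I) Ms))"
    using flag_contraction assms(3) by (metis finite_Diff)
  moreover have "E - I - J = E - (I \<union> J)" by blast
  ultimately show ?thesis by (simp add: comp_def)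
qed

end
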